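(* Let $S=\{-1,1\}$, $\gamma:=c(1,-1)=c(-1,1)$, $\rho\in[0,\infty)$, and let $Y$ be the stationary centered Gaussian process with $\mathbb{E}[Y_0(\phi)Y_0(\psi)]=\rho\langle\langle\phi,\psi\rangle\rangle$ solving $\mathrm{d}Y_t=A^*Y_t\,\mathrm{d}t+\sqrt{2\kappa\rho}\,\partial_x\,\mathrm{d}\mathscr{W}_t+\sqrt{2\rho\Sigma}\,\mathrm{d}\tilde{\mathscr{W}}_t$. Write $Y_t=(Y_{t,1},Y_{t,-1})$, i.e. $\langle\phi,Y_t\rangle=\langle\phi(\cdot,1),Y_{t,1}\rangle+\langle\phi(\cdot,-1),Y_{t,-1}\rangle$ for $\phi\in C_{c,S}^\infty$, and let $Z_t=Y_{t,1}+Y_{t,-1}$ be the limiting fluctuation process of the total density. For $\phi,\psi\in C_c^\infty(\mathbb{R})$ define $\bar\phi,\bar\psi\in C_{c,S}^\infty$ by $\bar\phi(x,\sigma)=\phi(x)$ and $\bar\psi(x,\sigma)=\psi(x)$. Then for all $t\ge0$ and all $\phi,\psi\in C_c^\infty(\mathbb{R})$, $$\mathbb{E}\big[\langle\phi,Z_t\rangle\langle\psi,Z_0\rangle\big]=\rho\cdot\langle\langle e^{tA}\bar\phi,\bar\psi\rangle\rangle.$$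
   Context: $\kappa,\lambda\ge0$ and $\gamma>0$ are constants. $C_{c,S}^\infty$ is the space of $\phi:\mathbb{R}\times S\to\mathbb{R}$ with $\phi(\cdot,\sigma)\in C_c^\infty(\mathbb{R})$ for all $\sigma\in S$, and $(C_{c,S}^\infty)^*$ its dual. $\langle\langle\phi,\psi\rangle\rangle=\sum_{\sigma\in S}\int_{\mathbb{R}}\phi(x,\sigma)\psi(x,\sigma)\,\mathrm{d}x$. Operators: $A\phi(x,\sigma)=(\kappa\partial_{xx}+\sigma\lambda\partial_x)\phi(x,\sigma)+\gamma(\phi(x,-\sigma)-\phi(x,\sigma))$; $A^*$ is its adjoint with respect to $\langle\langle\cdot,\cdot\rangle\rangle$ (replace $\lambda$ by $-\lambda$); $(\Sigma\phi)(x,\sigma)=-\gamma(\phi(x,-\sigma)-\phi(x,\sigma))$. $e^{tA}$ is the Markov semigroup generated by $A$ on functions $\phi$ with $\phi(\cdot,\sigma)\in C_0(\mathbb{R})$ for all $\sigma\in S$. Here $\mathrm{d}\mathscr{W}_t,\mathrm{d}\tilde{\mathscr{W}}_t$ are independent space-time white noises on $\mathbb{R}\times S$, and $Y$ (with values in $(C_{c,S}^\infty)^*$, $Y_t(\phi)=\langle\phi,Y_t\rangle$) solving the SPDE means: for every $\phi\in C_{c,S}^\infty$ the processes $\mathscr{M}^{\phi}_t(Y)=Y_t(\phi)-Y_0(\phi)-\int_0^tY_s(A\phi)\,\mathrm{d}s$ and $\mathscr{M}^{\phi}_t(Y)^2-2t\kappa\rho\langle\langle\partial_x\phi,\partial_x\phi\rangle\rangle-2t\rho\langle\langle\phi,\Sigma\phi\rangle\rangle$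 are martingales with respect to $\mathscr{F}_t=\sigma(Y_s:0\le s\le t)$. *)

theory Defs
  imports "HOL-Probability.Probability"
begin

section \<open>The two-point set $S = \{-1, 1\}$\<close>

datatype spin = Minus | Plus

primrec spin_val :: "spin \<Rightarrow> real" where
  "spin_val Minus = -1"
| "spin_val Plus = 1"

primrec flip :: "spin \<Rightarrow> spin" where
  "flip Minus = Plus"
| "flip Plus = Minus"

lemma UNIV_spin: "(UNIV :: spin set) = {Minus, Plus}"
  by (auto intro: spin.exhaust)

instance spin :: finite
  by standard (simp add: UNIV_spin)


section \<open>Test functions and their dual\<close>

definition smooth :: "(real \<Rightarrow> real) \<Rightarrow> bool" where
  "smooth f \<longleftrightarrow> (\<forall>n x. (deriv ^^ n) f field_differentiable (at x))"

definition Cc_infty :: "(real \<Rightarrow> real) set" where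
  "Cc_infty = {f. smooth f \<and> compact (closure {x. f x \<noteq> 0})}"

definition Cc_infty_S :: "(real \<times> spin \<Rightarrow> real) set" where
  "Cc_infty_S = {\<phi>. \<forall>\<sigma>. (\<lambda>x. \<phi> (x, \<sigma>)) \<in> Cc_infty}"

definition pairing :: "(real \<times> spin \<Rightarrow> real) \<Rightarrow> (real \<times> spin \<Rightarrow> real) \<Rightarrow> real" where
  "pairing \<phi> \<psi> = (\<Sum>\<sigma>\<in>UNIV. LINT x|lborel. \<phi> (x, \<sigma>) * \<psi> (x, \<sigma>))"

definition test_null_sequence :: "(nat \<Rightarrow> real \<times> spin \<Rightarrow> real) \<Rightarrow> bool" where
  "test_null_sequence \<phi> \<longleftrightarrow>
     (\<forall>n. \<phi> n \<in> Cc_infty_S) \<and>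
     (\<exists>K. compact K \<and> (\<forall>n x \<sigma>. x \<notin> K \<longrightarrow> \<phi> n (x, \<sigma>) = 0)) \<and>
     (\<forall>k \<sigma>. uniform_limit UNIV (\<lambda>n. (deriv ^^ k) (\<lambda>x. \<phi> n (x, \<sigma>))) (\<lambda>_. 0) sequentially)"

text \<open>The continuous dual (distributions). For linear functionals on the usual inductive limit
  topology, continuity is the same as sequential continuity at 0. Functionals are total
  functions; their values off the test functions carry no meaning.\<close>

definition dual_Cc_infty_S :: "((real \<times> spin \<Rightarrow> real) \<Rightarrow> real) set" where
  "dual_Cc_infty_S = {T.
     (\<forall>\<phi>\<in>Cc_infty_S. \<forall>\<psi>\<in>Cc_infty_S. \<forall>a b.
        T (\<lambda>p. a * \<phi> p + b * \<psi> p) = a * T \<phi> + b * T \<psi>) \<and>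
     (\<forall>\<phi>. test_null_sequence \<phi> \<longrightarrow> (\<lambda>n. T (\<phi> n)) \<longlonglongrightarrow> 0)}"

definition single :: "spin \<Rightarrow> (real \<Rightarrow> real) \<Rightarrow> real \<times> spin \<Rightarrow> real" where
  "single \<sigma> f = (\<lambda>(x, \<tau>). if \<tau> = \<sigma> then f x else 0)"

definition component :: "((real \<times> spin \<Rightarrow> real) \<Rightarrow> real) \<Rightarrow> spin \<Rightarrow> (real \<Rightarrow> real) \<Rightarrow> real" where
  "component T \<sigma> f = T (single \<sigma> f)"

definition total_density :: "((real \<times> spin \<Rightarrow> real) \<Rightarrow> real) \<Rightarrow> (real \<Rightarrow> real) \<Rightarrow> real" where
  "total_density T f = component T Plus f + component T Minus f"

definition lift_S :: "(real \<Rightarrow> real) \<Rightarrow> real \<times> spin \<Rightarrow> real" where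
  "lift_S f = (\<lambda>(x, \<sigma>). f x)"

lemma zero_in_Cc_infty: "(\<lambda>_. 0) \<in> Cc_infty"
proof -
  have "(deriv ^^ n) (\<lambda>_. 0 :: real) = (\<lambda>_. 0)" for n
    by (induction n) auto
  then show ?thesis
    by (simp add: Cc_infty_def smooth_def)
qed

lemma single_in_Cc_infty_S:
  assumes "f \<in> Cc_infty"
  shows "single \<sigma> f \<in> Cc_infty_S"
proof -
  have "(\<lambda>x. single \<sigma> f (x, \<tau>)) \<in> Cc_infty" for \<tau>
    using assms zero_in_Cc_infty by (cases "\<tau> = \<sigma>") (simp_all add: single_def)
  then show ?thesis
    by (simp add: Cc_infty_S_def)
qed

lemma component_decomposition:
  assumes "T \<in> dual_Cc_infty_S" "\<phi> \<in> Cc_infty_S"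
  shows "T \<phi> = component T Plus (\<lambda>x. \<phi> (x, Plus)) + component T Minus (\<lambda>x. \<phi> (x, Minus))"
proof -
  let ?p = "single Plus (\<lambda>x. \<phi> (x, Plus))" and ?m = "single Minus (\<lambda>x. \<phi> (x, Minus))"
  have in_test: "?p \<in> Cc_infty_S" "?m \<in> Cc_infty_S"
    by (rule single_in_Cc_infty_S, use assms(2) in \<open>simp add: Cc_infty_S_def\<close>)+
  have "T (\<lambda>p. 1 * ?p p + 1 * ?m p) = 1 * T ?p + 1 * T ?m"
    using assms(1) in_test unfolding dual_Cc_infty_S_def by blast
  moreover have "(\<lambda>p. 1 * ?p p + 1 * ?m p) = \<phi>"
  proof
    fix p
    show "1 * ?p p + 1 * ?m p = \<phi> p"
      by (cases p; cases "snd p") (auto simp: single_def)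
  qed
  ultimately show ?thesis
    by (simp add: component_def)
qed


section \<open>The operators\<close>

definition dx :: "(real \<times> spin \<Rightarrow> real) \<Rightarrow> real \<times> spin \<Rightarrow> real" where
  "dx \<phi> = (\<lambda>(x, \<sigma>). deriv (\<lambda>y. \<phi> (y, \<sigma>)) x)"

definition A_op :: "real \<Rightarrow> real \<Rightarrow> real \<Rightarrow> (real \<times> spin \<Rightarrow> real) \<Rightarrow> real \<times> spin \<Rightarrow> real" where
  "A_op \<kappa> lam \<gamma> \<phi> = (\<lambda>(x, \<sigma>).
     \<kappa> * dx (dx \<phi>) (x, \<sigma>) + spin_val \<sigma> * lam * dx \<phi> (x, \<sigma>)
       + \<gamma> * (\<phi> (x, flip \<sigma>) - \<phi> (x, \<sigma>)))"

definition Sigma_op :: "real \<Rightarrow> (real \<times> spin \<Rightarrow> real) \<Rightarrow> real \<times> spin \<Rightarrow> real" where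
  "Sigma_op \<gamma> \<phi> = (\<lambda>(x, \<sigma>). - \<gamma> * (\<phi> (x, flip \<sigma>) - \<phi> (x, \<sigma>)))"


section \<open>The Markov semigroup\<close>

definition C0_S :: "(real \<times> spin \<Rightarrow> real) set" where
  "C0_S = {f. \<forall>\<sigma>. continuous_on UNIV (\<lambda>x. f (x, \<sigma>)) \<and> ((\<lambda>x. f (x, \<sigma>)) \<longlongrightarrow> 0) at_infinity}"

text \<open>Positive, conservative, strongly continuous contraction semigroup. The last clause is
  conservativity, $P_t 1 = 1$, phrased inside $C_0$, which does not contain the constant 1.\<close>

definition markov_semigroup :: "(real \<Rightarrow> (real \<times> spin \<Rightarrow> real) \<Rightarrow> real \<times> spin \<Rightarrow> real) \<Rightarrow> bool" where
  "markov_semigroup P \<longleftrightarrow>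
     (\<forall>t\<ge>0. \<forall>f\<in>C0_S. P t f \<in> C0_S) \<and>
     (\<forall>t\<ge>0. \<forall>f\<in>C0_S. \<forall>g\<in>C0_S. \<forall>a b.
        P t (\<lambda>p. a * f p + b * g p) = (\<lambda>p. a * P t f p + b * P t g p)) \<and>
     (\<forall>f\<in>C0_S. P 0 f = f) \<and>
     (\<forall>s\<ge>0. \<forall>t\<ge>0. \<forall>f\<in>C0_S. P (s + t) f = P s (P t f)) \<and>
     (\<forall>f\<in>C0_S. uniform_limit UNIV (\<lambda>t. P t f) f (at_right 0)) \<and>
     (\<forall>t\<ge>0. \<forall>f\<in>C0_S. (\<forall>p. 0 \<le> f p \<and> f p \<le> 1) \<longrightarrow> (\<forall>p. 0 \<le> P t f p \<and> P t f p \<le> 1)) \<and>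
     (\<forall>t\<ge>0. \<forall>f :: nat \<Rightarrow> real \<times> spin \<Rightarrow> real.
        (\<forall>n. f n \<in> C0_S \<and> (\<forall>p. 0 \<le> f n p \<and> f n p \<le> 1)) \<and> (\<forall>p. (\<lambda>n. f n p) \<longlonglongrightarrow> 1)
        \<longrightarrow> (\<forall>p. (\<lambda>n. P t (f n) p) \<longlonglongrightarrow> 1))"

text \<open>\<open>generator P f g\<close>: \<open>f\<close> is in the domain of the infinitesimal generator, which maps it to \<open>g\<close>.\<close>

definition generator ::
  "(real \<Rightarrow> (real \<times> spin \<Rightarrow> real) \<Rightarrow> real \<times> spin \<Rightarrow> real) \<Rightarrow>
   (real \<times> spin \<Rightarrow> real) \<Rightarrow> (real \<times> spin \<Rightarrow> real) \<Rightarrow> bool" where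
  "generator P f g \<longleftrightarrow> f \<in> C0_S \<and> g \<in> C0_S \<and>
     uniform_limit UNIV (\<lambda>t p. (P t f p - f p) / t) g (at_right 0)"

text \<open>An operator \<open>L\<close> on the test functions generates \<open>P\<close> if the generator of \<open>P\<close> is the closure
  of \<open>L\<close>, i.e. the graph of the generator is the sup-norm closure of the graph of \<open>L\<close>.\<close>

definition generates ::
  "((real \<times> spin \<Rightarrow> real) \<Rightarrow> real \<times> spin \<Rightarrow> real) \<Rightarrow>
   (real \<Rightarrow> (real \<times> spin \<Rightarrow> real) \<Rightarrow> real \<times> spin \<Rightarrow> real) \<Rightarrow> bool" where
  "generates L P \<longleftrightarrow> markov_semigroup P \<and>
     (\<forall>f g. generator P f g \<longleftrightarrow>
        (\<exists>\<phi> :: nat \<Rightarrow> real \<times> spin \<Rightarrow> real. (\<forall>n. \<phi> n \<in> Cc_infty_S) \<and>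
           uniform_limit UNIV \<phi> f sequentially \<and>
           uniform_limit UNIV (\<lambda>n. L (\<phi> n)) g sequentially))"


section \<open>Processes with values in the dual\<close>

text \<open>Time is \<open>{0..}\<close>; values at negative times carry no meaning. Joint measurability is what
  makes time integrals of \<open>Y\<close> random variables; it holds e.g. for processes with right-continuous
  paths.\<close>

definition dual_process :: "'w measure \<Rightarrow> (real \<Rightarrow> 'w \<Rightarrow> (real \<times> spin \<Rightarrow> real) \<Rightarrow> real) \<Rightarrow> bool" where
  "dual_process M Y \<longleftrightarrow>
     (\<forall>t\<ge>0. \<forall>w\<in>space M. Y t w \<in> dual_Cc_infty_S) \<and>
     (\<forall>t\<ge>0. \<forall>\<phi>\<in>Cc_infty_S. (\<lambda>w. Y t w \<phi>) \<in> borel_measurable M) \<and>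
     (\<forall>\<phi>\<in>Cc_infty_S. (\<lambda>(s, w). Y s w \<phi>)
        \<in> borel_measurable (restrict_space borel {0..} \<Otimes>\<^sub>M M))"

definition stationary_process :: "'w measure \<Rightarrow> (real \<Rightarrow> 'w \<Rightarrow> (real \<times> spin \<Rightarrow> real) \<Rightarrow> real) \<Rightarrow> bool" where
  "stationary_process M Y \<longleftrightarrow>
     (\<forall>h\<ge>0. \<forall>(n::nat) t \<phi>. (\<forall>i<n. t i \<ge> 0 \<and> \<phi> i \<in> Cc_infty_S) \<longrightarrow>
        distr M (PiM {..<n} (\<lambda>_. borel)) (\<lambda>w. \<lambda>i\<in>{..<n}. Y (t i + h) w (\<phi> i)) =
        distr M (PiM {..<n} (\<lambda>_. borel)) (\<lambda>w. \<lambda>i\<in>{..<n}. Y (t i) w (\<phi> i)))"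

text \<open>The first case is the degenerate normal law with variance 0.\<close>

definition centered_normal :: "'w measure \<Rightarrow> ('w \<Rightarrow> real) \<Rightarrow> bool" where
  "centered_normal M X \<longleftrightarrow> X \<in> borel_measurable M \<and>
     ((AE w in M. X w = 0) \<or> (\<exists>s>0. distributed M lborel X (normal_density 0 s)))"

definition centered_gaussian_process ::
  "'w measure \<Rightarrow> (real \<Rightarrow> 'w \<Rightarrow> (real \<times> spin \<Rightarrow> real) \<Rightarrow> real) \<Rightarrow> bool" where
  "centered_gaussian_process M Y \<longleftrightarrow>
     (\<forall>(n::nat) t \<phi> a. (\<forall>i<n. t i \<ge> 0 \<and> \<phi> i \<in> Cc_infty_S) \<longrightarrow>
        centered_normal M (\<lambda>w. \<Sum>i<n. a i * Y (t i) w (\<phi> i)))"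

definition natural_filtration ::
  "'w measure \<Rightarrow> (real \<Rightarrow> 'w \<Rightarrow> (real \<times> spin \<Rightarrow> real) \<Rightarrow> real) \<Rightarrow> real \<Rightarrow> 'w measure" where
  "natural_filtration M Y t = sigma (space M)
     {(\<lambda>w. Y s w \<phi>) -` B \<inter> space M | s \<phi> B. 0 \<le> s \<and> s \<le> t \<and> \<phi> \<in> Cc_infty_S \<and> B \<in> sets borel}"

definition martingale :: "'w measure \<Rightarrow> (real \<Rightarrow> 'w measure) \<Rightarrow> (real \<Rightarrow> 'w \<Rightarrow> real) \<Rightarrow> bool" where
  "martingale M F X \<longleftrightarrow>
     (\<forall>t\<ge>0. X t \<in> borel_measurable (F t) \<and> integrable M (X t)) \<and>
     (\<forall>s\<ge>0. \<forall>t\<ge>s. AE w in M. real_cond_exp M (F s) (X t) w = X s w)"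

definition Mart ::
  "real \<Rightarrow> real \<Rightarrow> real \<Rightarrow> (real \<Rightarrow> 'w \<Rightarrow> (real \<times> spin \<Rightarrow> real) \<Rightarrow> real) \<Rightarrow>
   (real \<times> spin \<Rightarrow> real) \<Rightarrow> real \<Rightarrow> 'w \<Rightarrow> real" where
  "Mart \<kappa> lam \<gamma> Y \<phi> t w =
     Y t w \<phi> - Y 0 w \<phi> - (LINT s:{0..t}|lborel. Y s w (A_op \<kappa> lam \<gamma> \<phi>))"

text \<open>Solution, in the sense of the martingale problem, of
  $dY = A^* Y\,dt + \sqrt{2\kappa\rho}\,\partial_x\,dW + \sqrt{2\rho\Sigma}\,d\tilde W$.
  The first clause says that the time integrals in \<^const>\<open>Mart\<close> exist.\<close>

definition solves_SPDE ::
  "real \<Rightarrow> real \<Rightarrow> real \<Rightarrow> real \<Rightarrow> 'w measure \<Rightarrow>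
   (real \<Rightarrow> 'w \<Rightarrow> (real \<times> spin \<Rightarrow> real) \<Rightarrow> real) \<Rightarrow> bool" where
  "solves_SPDE \<kappa> lam \<gamma> \<rho> M Y \<longleftrightarrow>
     (\<forall>\<phi>\<in>Cc_infty_S.
        (\<forall>t\<ge>0. AE w in M. set_integrable lborel {0..t} (\<lambda>s. Y s w (A_op \<kappa> lam \<gamma> \<phi>))) \<and>
        martingale M (natural_filtration M Y) (Mart \<kappa> lam \<gamma> Y \<phi>) \<and>
        martingale M (natural_filtration M Y)
          (\<lambda>t w. (Mart \<kappa> lam \<gamma> Y \<phi> t w)\<^sup>2
             - 2 * t * \<kappa> * \<rho> * pairing (dx \<phi>) (dx \<phi>)
             - 2 * t * \<rho> * pairing \<phi> (Sigma_op \<gamma> \<phi>)))"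

end

theory Submission
  imports Defs
begin

text \<open>For a test function \<open>f\<close> let \<open>D\<^sub>t f\<close> be the covariance of \<open>Y\<^sub>t f\<close> and \<open>Z\<^sub>0 \<psi>\<close> minus
  \<open>\<rho>\<close> times the pairing of \<open>P\<^sub>t f\<close> with the lift of \<open>\<psi>\<close>. It vanishes at \<open>t = 0\<close> and satisfies
  \<open>d/dt D\<^sub>t f = D\<^sub>t (A f)\<close>: for the first term by the martingale property, for the second because
  \<open>A\<close> is the generator. The first term is continuous in \<open>f\<close> for the \<open>L\<^sup>2\<close> norm, the second for
  the sup norm, so \<open>D\<close> is bounded uniformly in time over all translates of \<open>f\<close>. Since \<open>A\<close> commutes
  with translations, \<open>D\<close> evaluated at translates is a bounded classical solution of a parabolic
  system with zero initial data, which is zero by the maximum principle.\<close>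

section \<open>Test functions\<close>

text \<open>The direct route would insert \<open>P (t - s)\<close> applied to the lift of
  \<open>\<phi>\<close> into the martingale problem. That function lies in \<open>C0_S\<close> but
  is in general not compactly supported, so neither the martingale problem nor the values of
  \<open>Y\<close> say anything about it. Hence the test function stays fixed and the linear
  functional \<open>D\<close> evolves instead; its uniqueness problem must be solved with test
  functions only. Translates achieve this: derivatives in the translation parameter fall on the test
  function, so regularity in space costs nothing. No parabolic smoothing is used, and
  \<open>\<kappa> = 0\<close> is covered. The two norms are reconciled by restricting to functions
  of sup norm at most \<open>m\<close> supported within distance \<open>L\<close> of a centre
  \<open>c\<close>: there the square of the L2 norm is at most a multiple of \<open>m\<close>
  squared. The constant depends on \<open>L\<close> but not on \<open>c\<close>, which is what makes
  the bounds uniform over translates.\<close>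

lemma smooth_has_deriv: "smooth f \<Longrightarrow> (f has_real_derivative deriv f x) (at x)"
  unfolding smooth_def using DERIV_deriv_iff_field_differentiable[of f x]
  by (metis funpow_0)

lemma smooth_deriv: "smooth f \<Longrightarrow> smooth (deriv f)"
  unfolding smooth_def
  by (metis comp_apply funpow_Suc_right)

lemma smooth_continuous_on: "smooth f \<Longrightarrow> continuous_on A f"
  by (meson DERIV_isCont continuous_at_imp_continuous_on smooth_has_deriv)

lemma deriv_funpow_lincomb:
  assumes "smooth f" "smooth g"
  shows "(deriv ^^ n) (\<lambda>x. a * f x + b * g x) = (\<lambda>x. a * (deriv ^^ n) f x + b * (deriv ^^ n) g x)"
proof (induction n)
  case (Suc n)
  have "((\<lambda>x. a * (deriv ^^ n) f x + b * (deriv ^^ n) g x) has_real_derivative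
      a * deriv ((deriv ^^ n) f) x + b * deriv ((deriv ^^ n) g) x) (at x)" for x
    using assms unfolding smooth_def
    by (intro derivative_eq_intros DERIV_cmult)
       (auto simp: DERIV_deriv_iff_field_differentiable)
  then show ?case
    by (auto simp: Suc.IH fun_eq_iff intro!: DERIV_imp_deriv)
qed simp

lemma smooth_lincomb:
  assumes "smooth f" "smooth g"
  shows "smooth (\<lambda>x. a * f x + b * g x)"
  using assms unfolding smooth_def deriv_funpow_lincomb[OF assms]
  by (auto intro!: derivative_intros field_differentiable_add field_differentiable_mult)

lemma DERIV_shift_minus:
  "(f has_real_derivative D) (at (x - y)) \<Longrightarrow> ((\<lambda>x. f (x - y)) has_real_derivative D) (at x)"
  using DERIV_shift[of f D x "- y"] by simp

lemma deriv_funpow_shift: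
  assumes "smooth f"
  shows "(deriv ^^ n) (\<lambda>x. f (x - y)) = (\<lambda>x. (deriv ^^ n) f (x - y))"
proof (induction n)
  case (Suc n)
  have "((\<lambda>x. (deriv ^^ n) f (x - y)) has_real_derivative deriv ((deriv ^^ n) f) (x - y)) (at x)" for x
  proof -
    have "((deriv ^^ n) f has_real_derivative deriv ((deriv ^^ n) f) (x - y)) (at (x - y))"
      using assms unfolding smooth_def by (simp add: DERIV_deriv_iff_field_differentiable)
    then show ?thesis
      by (rule DERIV_shift_minus)
  qed
  then show ?case
    by (auto simp: Suc.IH fun_eq_iff intro!: DERIV_imp_deriv)
qed simp

lemma smooth_shift:
  assumes "smooth f"
  shows "smooth (\<lambda>x. f (x - y))"
  unfolding smooth_def deriv_funpow_shift[OF assms]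
proof (intro allI)
  fix n x
  have "((deriv ^^ n) f has_real_derivative deriv ((deriv ^^ n) f) (x - y)) (at (x - y))"
    using assms unfolding smooth_def by (simp add: DERIV_deriv_iff_field_differentiable)
  from DERIV_shift_minus[OF this]
  show "(\<lambda>x. (deriv ^^ n) f (x - y)) field_differentiable at x"
    by (auto simp: field_differentiable_def)
qed

section \<open>Smooth functions of compact support\<close>

lemma Cc_infty_iff:
  "f \<in> Cc_infty \<longleftrightarrow> smooth f \<and> (\<exists>B. \<forall>x. B < \<bar>x\<bar> \<longrightarrow> f x = 0)"
proof -
  have "compact (closure {x. f x \<noteq> 0}) \<longleftrightarrow> bounded {x. f x \<noteq> 0}"
    by simp
  also have "\<dots> \<longleftrightarrow> (\<exists>B. \<forall>x. B < \<bar>x\<bar> \<longrightarrow> f x = 0)"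
    unfolding bounded_iff real_norm_def Ball_def mem_Collect_eq by (meson not_le)
  finally show ?thesis
    by (simp add: Cc_infty_def)
qed

lemma Cc_infty_lincomb:
  assumes "f \<in> Cc_infty" "g \<in> Cc_infty"
  shows "(\<lambda>x. a * f x + b * g x) \<in> Cc_infty"
proof -
  obtain B C where B: "\<And>x. B < \<bar>x\<bar> \<Longrightarrow> f x = 0" "\<And>x. C < \<bar>x\<bar> \<Longrightarrow> g x = 0"
    using assms unfolding Cc_infty_iff by blast
  have "\<forall>x. max B C < \<bar>x\<bar> \<longrightarrow> a * f x + b * g x = 0"
    by (simp add: B)
  then show ?thesis
    using assms smooth_lincomb unfolding Cc_infty_iff by blast
qed

lemma Cc_infty_shift:
  assumes "f \<in> Cc_infty"
  shows "(\<lambda>x. f (x - y)) \<in> Cc_infty"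
proof -
  obtain B where B: "\<And>x. B < \<bar>x\<bar> \<Longrightarrow> f x = 0"
    using assms unfolding Cc_infty_iff by blast
  have "\<forall>x. B + \<bar>y\<bar> < \<bar>x\<bar> \<longrightarrow> f (x - y) = 0"
    by (auto intro!: B)
  then show ?thesis
    using assms smooth_shift unfolding Cc_infty_iff by blast
qed

lemma deriv_zero_outside_support:
  assumes "\<And>x. B < \<bar>x\<bar> \<Longrightarrow> f x = 0" "B < \<bar>x\<bar>"
  shows "deriv f x = (0::real)"
proof -
  \<comment> \<open>The strict inequality makes this region open, so \<open>f\<close> vanishes on a
    neighbourhood of \<open>x\<close>. The same radius \<open>B\<close> therefore serves for the
    derivative.\<close>
  have "open {x::real. B < \<bar>x\<bar>}"
    by (intro open_Collect_less continuous_intros)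
  moreover have "((\<lambda>_. 0) has_real_derivative 0) (at x)"
    by simp
  ultimately have "(f has_real_derivative 0) (at x)"
    using assms by (subst DERIV_cong_ev[OF refl _ refl, where g = "\<lambda>_. 0"])
      (auto simp: eventually_nhds)
  then show ?thesis
    by (rule DERIV_imp_deriv)
qed

lemma Cc_infty_deriv:
  assumes "f \<in> Cc_infty"
  shows "deriv f \<in> Cc_infty"
  using assms smooth_deriv deriv_zero_outside_support unfolding Cc_infty_iff by blast

lemma Cc_infty_bounded:
  assumes "f \<in> Cc_infty"
  obtains m where "m \<ge> 0" "\<And>x. \<bar>f x\<bar> \<le> m"
proof -
  obtain B where B: "\<And>x. B < \<bar>x\<bar> \<Longrightarrow> f x = 0"
    using assms unfolding Cc_infty_iff by blast
  have "compact (f ` {-B..B})"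
    using assms by (intro compact_continuous_image smooth_continuous_on) (auto simp: Cc_infty_iff)
  then obtain m where m: "\<And>x. x \<in> {-B..B} \<Longrightarrow> \<bar>f x\<bar> \<le> m"
    unfolding compact_eq_bounded_closed bounded_iff by fastforce
  have "\<bar>f x\<bar> \<le> max 0 m" for x
    using B[of x] m[of x] by (cases "B < \<bar>x\<bar>") fastforce+
  then show ?thesis
    by (intro that[of "max 0 m"]) auto
qed

lemma Cc_infty_integrable:
  assumes "f \<in> Cc_infty"
  shows "integrable lborel f"
proof -
  obtain B where B: "\<And>x. B < \<bar>x\<bar> \<Longrightarrow> f x = 0"
    using assms unfolding Cc_infty_iff by blast
  have "set_integrable lborel {-B..B} f"
    using assms unfolding set_integrable_def
    by (intro borel_integrable_compact) (auto simp: Cc_infty_iff smooth_continuous_on)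
  moreover have "(\<lambda>x. indicator {-B..B} x *\<^sub>R f x) = f"
    using B by (force simp: fun_eq_iff indicator_def)
  ultimately show ?thesis
    by (simp add: set_integrable_def)
qed

text \<open>The mean value inequality is applied twice: to \<open>deriv f\<close>, and then to
  \<open>f\<close> minus its tangent slope at \<open>z\<close> times \<open>x\<close>. The second
  step loses the factor 1/2 of Taylor's formula, which is harmless. The bound makes difference
  quotients of translates converge in sup norm.\<close>

lemma smooth_taylor_bound:
  assumes "smooth f" "\<And>x. \<bar>deriv (deriv f) x\<bar> \<le> m"
  shows "\<bar>f (z + k) - f z - k * deriv f z\<bar> \<le> m * k\<^sup>2"
proof -
  define I where "I = {z - \<bar>k\<bar>..z + \<bar>k\<bar>}"
  have m: "m \<ge> 0"
    using assms(2)[of 0] by simp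
  have 1: "\<bar>deriv f x - deriv f z\<bar> \<le> m * \<bar>k\<bar>" if "x \<in> I" for x
  proof -
    have "norm (deriv f x - deriv f z) \<le> m * norm (x - z)"
      by (rule field_differentiable_bound[of UNIV _ "deriv (deriv f)"])
         (use assms smooth_deriv smooth_has_deriv in auto)
    also have "\<dots> \<le> m * \<bar>k\<bar>"
      using that m by (intro mult_left_mono) (auto simp: I_def)
    finally show ?thesis by simp
  qed
  have "norm ((f (z + k) - (z + k) * deriv f z) - (f z - z * deriv f z)) \<le> m * \<bar>k\<bar> * norm ((z + k) - z)"
  proof (rule field_differentiable_bound[of I "\<lambda>x. f x - x * deriv f z" "\<lambda>x. deriv f x - deriv f z"])
    fix x
    show "((\<lambda>x. f x - x * deriv f z) has_field_derivative deriv f x - deriv f z) (at x within I)"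
      using assms by (auto intro!: derivative_eq_intros has_field_derivative_at_within[OF smooth_has_deriv])
  qed (use 1 in \<open>auto simp: I_def\<close>)
  then show ?thesis
    by (simp add: algebra_simps power2_eq_square)
qed

lemma Cc_infty_S_lincomb:
  assumes "f \<in> Cc_infty_S" "g \<in> Cc_infty_S"
  shows "(\<lambda>p. a * f p + b * g p) \<in> Cc_infty_S"
  using assms Cc_infty_lincomb unfolding Cc_infty_S_def by blast

lemma Cc_infty_S_bounded:
  assumes "f \<in> Cc_infty_S"
  obtains m where "m \<ge> 0" "\<And>p. \<bar>f p\<bar> \<le> m"
proof -
  have "(\<lambda>x. f (x, Plus)) \<in> Cc_infty" "(\<lambda>x. f (x, Minus)) \<in> Cc_infty"
    using assms by (auto simp: Cc_infty_S_def)
  then obtain m n where *: "m \<ge> 0" "\<And>x. \<bar>f (x, Plus)\<bar> \<le> m" "\<And>x. \<bar>f (x, Minus)\<bar> \<le> n"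
    by (metis Cc_infty_bounded)
  have "\<bar>f p\<bar> \<le> max m n" for p
    using *(2,3)[of "fst p"] by (cases p; cases "snd p") (auto simp: le_max_iff_disj)
  then show ?thesis
    using * by (intro that[of "max m n"]) auto
qed

lemma Cc_infty_S_support:
  assumes "f \<in> Cc_infty_S"
  obtains B where "\<And>x \<sigma>. B < \<bar>x\<bar> \<Longrightarrow> f (x, \<sigma>) = 0"
proof -
  have "(\<lambda>x. f (x, Plus)) \<in> Cc_infty" "(\<lambda>x. f (x, Minus)) \<in> Cc_infty"
    using assms by (auto simp: Cc_infty_S_def)
  then obtain B C where "\<And>x. B < \<bar>x\<bar> \<Longrightarrow> f (x, Plus) = 0" "\<And>x. C < \<bar>x\<bar> \<Longrightarrow> f (x, Minus) = 0"
    by (auto simp: Cc_infty_iff)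
  then have "f (x, \<sigma>) = 0" if "max B C < \<bar>x\<bar>" for x \<sigma>
    using that by (cases \<sigma>) auto
  then show ?thesis
    by (rule that)
qed

lemma A_op_in_Cc_infty_S:
  assumes "f \<in> Cc_infty_S"
  shows "A_op \<kappa> lam \<gamma> f \<in> Cc_infty_S"
  unfolding Cc_infty_S_def
proof (intro CollectI allI)
  fix \<sigma>
  define u where "u \<tau> = (\<lambda>x. f (x, \<tau>))" for \<tau>
  have u: "u \<tau> \<in> Cc_infty" for \<tau>
    using assms by (simp add: Cc_infty_S_def u_def)
  have "(\<lambda>x. A_op \<kappa> lam \<gamma> f (x, \<sigma>)) = (\<lambda>x. 1 * (\<kappa> * deriv (deriv (u \<sigma>)) x
      + spin_val \<sigma> * lam * deriv (u \<sigma>) x) + 1 * (\<gamma> * u (flip \<sigma>) x + (- \<gamma>) * u \<sigma> x))"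
    by (auto simp: A_op_def dx_def u_def algebra_simps)
  also have "\<dots> \<in> Cc_infty"
    by (intro Cc_infty_lincomb u Cc_infty_deriv)
  finally show "(\<lambda>x. A_op \<kappa> lam \<gamma> f (x, \<sigma>)) \<in> Cc_infty" .
qed

text \<open>Jumps create the component \<open>flip \<sigma>\<close>, which couples the two spins.
  The redundant factors 1 give the right side the shape of nested linear combinations, so that
  linearity of a functional can be applied by plain rewriting.\<close>

lemma A_op_single:
  "A_op \<kappa> lam \<gamma> (single \<sigma> f) = (\<lambda>p.
     1 * (\<kappa> * single \<sigma> (deriv (deriv f)) p + spin_val \<sigma> * lam * single \<sigma> (deriv f) p)
     + 1 * (\<gamma> * single (flip \<sigma>) f p + (- \<gamma>) * single \<sigma> f p))"
proof
  fix p :: "real \<times> spin"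
  obtain x \<tau> where p: "p = (x, \<tau>)" by (cases p)
  show "A_op \<kappa> lam \<gamma> (single \<sigma> f) p = 1 * (\<kappa> * single \<sigma> (deriv (deriv f)) p + spin_val \<sigma> * lam * single \<sigma> (deriv f) p)
     + 1 * (\<gamma> * single (flip \<sigma>) f p + (- \<gamma>) * single \<sigma> f p)"
    unfolding p by (cases \<sigma>; cases \<tau>) (simp_all add: A_op_def dx_def single_def algebra_simps)
qed

section \<open>A maximum principle\<close>

text \<open>If \<open>c\<close> were positive, \<open>f'\<close> would be positive just to the right
  of its zero \<open>a\<close>, and by the mean value theorem \<open>f\<close> would exceed
  \<open>f a\<close> there.\<close>

lemma local_max_second_deriv_nonpos:
  fixes f f' :: "real \<Rightarrow> real"
  assumes f: "\<And>x. (f has_real_derivative f' x) (at x)"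
    and f': "(f' has_real_derivative c) (at a)"
    and "d > 0" and max: "\<And>x. \<bar>x - a\<bar> < d \<Longrightarrow> f x \<le> f a"
  shows "f' a = 0" "c \<le> 0"
proof -
  show zero: "f' a = 0"
    using DERIV_local_max[OF f \<open>d > 0\<close>] max by (simp add: abs_minus_commute)
  show "c \<le> 0"
  proof (rule ccontr)
    assume "\<not> c \<le> 0"
    then obtain e where e: "e > 0" "\<And>h. 0 < h \<Longrightarrow> h < e \<Longrightarrow> f' a < f' (a + h)"
      using DERIV_pos_inc_right[OF f'] by auto
    define h where "h = min d e / 2"
    have h: "h > 0" "h < d" "h < e"
      using e \<open>d > 0\<close> by (auto simp: h_def min_def)
    obtain z where z: "a < z" "z < a + h" "f (a + h) - f a = (a + h - a) * f' z"
      using MVT2[of a "a + h" f f'] f h by auto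
    have "f' z > 0"
      using e(2)[of "z - a"] z h zero by auto
    then have "f (a + h) > f a"
      using z(3) mult_pos_pos[OF h(1), of "f' z"] by simp
    then show False
      using max[of "a + h"] h by auto
  qed
qed

text \<open>At a positive maximum of \<open>v \<sigma> s y - \<epsilon> * exp (K * s) * (1 + y\<^sup>2)\<close> over the time-space
  strip and both components, the coupling term is nonpositive, so the strict supersolution
  property of the barrier contradicts the equation.\<close>

lemma spin_maximum_principle:
  fixes v v1 v2 vt :: "spin \<Rightarrow> real \<Rightarrow> real \<Rightarrow> real" and b :: "spin \<Rightarrow> real"
  assumes "\<kappa> \<ge> 0" "\<gamma> \<ge> 0"
    and bound: "\<And>\<sigma> s y. 0 \<le> s \<Longrightarrow> v \<sigma> s y \<le> B"
    and cont: "\<And>\<sigma>. continuous_on ({0..} \<times> UNIV) (\<lambda>(s, y). v \<sigma> s y)"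
    and d1: "\<And>\<sigma> s y. 0 \<le> s \<Longrightarrow> (v \<sigma> s has_real_derivative v1 \<sigma> s y) (at y)"
    and d2: "\<And>\<sigma> s y. 0 \<le> s \<Longrightarrow> (v1 \<sigma> s has_real_derivative v2 \<sigma> s y) (at y)"
    and dt: "\<And>\<sigma> s y. 0 < s \<Longrightarrow> ((\<lambda>s. v \<sigma> s y) has_real_derivative
        \<kappa> * v2 \<sigma> s y + b \<sigma> * v1 \<sigma> s y + \<gamma> * (v (flip \<sigma>) s y - v \<sigma> s y)) (at s)"
    and init: "\<And>\<sigma> y. v \<sigma> 0 y \<le> 0"
    and t: "t \<ge> 0"
  shows "v \<sigma> t y \<le> 0"
proof -
  \<comment> \<open>\<open>2 * \<kappa>\<close> absorbs the second derivative of the barrier, the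
    drift term is absorbed through \<open>2 * \<bar>y\<bar> \<le> 1 + y\<^sup>2\<close>, and the
    final 1 makes the inequality strict for either spin.\<close>
  define K where "K = 2 * \<kappa> + \<bar>b Plus\<bar> + \<bar>b Minus\<bar> + 1"
  have K: "2 * \<kappa> + \<bar>b \<sigma>\<bar> < K" for \<sigma>
    by (cases \<sigma>) (auto simp: K_def)
  have barrier: "v \<sigma> t y \<le> \<epsilon> * (exp (K * t) * (1 + y\<^sup>2))" if \<epsilon>: "\<epsilon> > 0" for \<epsilon> \<sigma> y
  proof (rule ccontr)
    assume neg: "\<not> v \<sigma> t y \<le> \<epsilon> * (exp (K * t) * (1 + y\<^sup>2))"
    define w where "w \<sigma> s y = v \<sigma> s y - \<epsilon> * (exp (K * s) * (1 + y\<^sup>2))" for \<sigma> s y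
    \<comment> \<open>For \<open>\<bar>y\<bar> \<ge> R\<close> the barrier exceeds the global bound
      \<open>B\<close>: \<open>R \<ge> 1\<close> gives \<open>\<bar>y\<bar> \<le> y\<^sup>2\<close>,
      and \<open>R \<ge> B / \<epsilon>\<close> does the rest. This reduces the search for a maximum
      to a compact set.\<close>
    define R where "R = max 1 (B / \<epsilon>)"
    have K0: "K > 0"
      using \<open>\<kappa> \<ge> 0\<close> by (simp add: K_def)
    have far: "w \<sigma> s y \<le> 0" if "0 \<le> s" "R \<le> \<bar>y\<bar>" for \<sigma> s y
    proof -
      have "1 * \<bar>y\<bar> \<le> \<bar>y\<bar> * \<bar>y\<bar>"
        using that by (intro mult_right_mono) (auto simp: R_def)
      then have "B / \<epsilon> \<le> 1 + y\<^sup>2"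
        using that by (auto simp: R_def power2_eq_square abs_mult_self_eq)
      then have "B \<le> \<epsilon> * (1 + y\<^sup>2)"
        using \<epsilon> by (simp add: field_simps)
      also have "1 * (1 + y\<^sup>2) \<le> exp (K * s) * (1 + y\<^sup>2)"
        using that K0 by (intro mult_right_mono) auto
      then have "\<epsilon> * (1 + y\<^sup>2) \<le> \<epsilon> * (exp (K * s) * (1 + y\<^sup>2))"
        using \<epsilon> by (intro mult_left_mono) auto
      finally show ?thesis
        using bound[OF that(1), of \<sigma> y] by (simp add: w_def)
    qed
    define Q where "Q = {0..t} \<times> {-R..R}"
    have "compact Q" "Q \<noteq> {}"
      using t by (auto simp: Q_def R_def intro!: compact_Times)
    moreover have "continuous_on Q (\<lambda>(s, y). w \<sigma> s y)" for \<sigma>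
    proof -
      have "continuous_on Q (\<lambda>(s, y). v \<sigma> s y)"
        by (rule continuous_on_subset[OF cont]) (auto simp: Q_def)
      then show ?thesis
        unfolding w_def case_prod_beta by (intro continuous_intros)
    qed
    ultimately have "\<exists>q. q \<in> Q \<and> (\<forall>p\<in>Q. w \<sigma> (fst p) (snd p) \<le> w \<sigma> (fst q) (snd q))" for \<sigma>
      using continuous_attains_sup[of Q "\<lambda>(s, y). w \<sigma> s y"] unfolding case_prod_beta by blast
    then have "\<exists>q. \<forall>\<sigma>. q \<sigma> \<in> Q \<and> (\<forall>p\<in>Q. w \<sigma> (fst p) (snd p) \<le> w \<sigma> (fst (q \<sigma>)) (snd (q \<sigma>)))"
      by (intro choice allI)
    then obtain q where q: "\<And>\<sigma>. q \<sigma> \<in> Q"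
        "\<And>\<sigma> p. p \<in> Q \<Longrightarrow> w \<sigma> (fst p) (snd p) \<le> w \<sigma> (fst (q \<sigma>)) (snd (q \<sigma>))"
      by blast
    define m where "m \<sigma> = w \<sigma> (fst (q \<sigma>)) (snd (q \<sigma>))" for \<sigma>
    \<comment> \<open>The spin with the larger maximum is selected, because only there is the sign
      of the coupling term known.\<close>
    have "\<exists>\<sigma>0. \<forall>\<tau>. m \<tau> \<le> m \<sigma>0"
    proof (cases "m Plus \<le> m Minus")
      case True
      then have "m \<tau> \<le> m Minus" for \<tau> by (cases \<tau>) auto
      then show ?thesis by blast
    next
      case False
      then have "m \<tau> \<le> m Plus" for \<tau> by (cases \<tau>) auto
      then show ?thesis by blast
    qed
    then obtain \<sigma>0 where \<sigma>0: "\<And>\<tau>. w \<tau> (fst (q \<tau>)) (snd (q \<tau>)) \<le> w \<sigma>0 (fst (q \<sigma>0)) (snd (q \<sigma>0))"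
      unfolding m_def by blast
    define s0 where "s0 = fst (q \<sigma>0)"
    define y0 where "y0 = snd (q \<sigma>0)"
    have mem: "0 \<le> s0" "s0 \<le> t"
      using q(1)[of \<sigma>0] by (auto simp: Q_def s0_def)
    have near: "w \<tau> s z \<le> w \<sigma>0 s0 y0" if "s \<in> {0..t}" "\<bar>z\<bar> \<le> R" for \<tau> s z
      using q(2)[of "(s, z)" \<tau>] \<sigma>0[of \<tau>] that by (auto simp: Q_def s0_def y0_def abs_le_iff)
    have pos: "w \<sigma>0 s0 y0 > 0"
    proof -
      have "w \<sigma> t y > 0" using neg by (simp add: w_def)
      then show ?thesis
        using far[OF t, of y \<sigma>] near[of t y \<sigma>] t by (cases "R \<le> \<bar>y\<bar>") auto
    qed
    have max: "w \<tau> s z \<le> w \<sigma>0 s0 y0" if "s \<in> {0..t}" for \<tau> s z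
      using near[OF that, of z \<tau>] far[of s z \<tau>] pos that by (cases "R \<le> \<bar>z\<bar>") auto
    have s0: "s0 > 0"
    proof (rule ccontr)
      assume "\<not> s0 > 0"
      then have "s0 = 0" using mem by simp
      moreover have "0 \<le> \<epsilon> * (1 + y0\<^sup>2)" using \<epsilon> by simp
      ultimately show False
        using pos init[of \<sigma>0 y0] by (simp add: w_def)
    qed
    define E where "E = \<epsilon> * exp (K * s0)"
    have E: "E > 0" using \<epsilon> by (simp add: E_def)
    have w1: "(w \<sigma>0 s0 has_real_derivative v1 \<sigma>0 s0 y - E * (2 * y)) (at y)" for y
      unfolding w_def E_def
      by (rule derivative_eq_intros d1[OF mem(1)] refl | simp)+
    have w2: "((\<lambda>y. v1 \<sigma>0 s0 y - E * (2 * y)) has_real_derivative v2 \<sigma>0 s0 y0 - E * 2) (at y0)"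
      by (rule derivative_eq_intros d2[OF mem(1)] refl | simp)+
    have space: "v1 \<sigma>0 s0 y0 = E * (2 * y0)" "v2 \<sigma>0 s0 y0 \<le> E * 2"
      using local_max_second_deriv_nonpos[OF w1 w2, of 1] max mem by auto
    define D where "D = \<kappa> * v2 \<sigma>0 s0 y0 + b \<sigma>0 * v1 \<sigma>0 s0 y0
      + \<gamma> * (v (flip \<sigma>0) s0 y0 - v \<sigma>0 s0 y0) - K * (E * (1 + y0\<^sup>2))"
    have wt: "((\<lambda>s. w \<sigma>0 s y0) has_real_derivative D) (at s0)"
      unfolding w_def E_def D_def
      by (rule derivative_eq_intros dt[OF s0] refl | simp)+
    have "D < 0"
    proof -
      have "\<kappa> * v2 \<sigma>0 s0 y0 \<le> \<kappa> * (E * 2)"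
        using space \<open>\<kappa> \<ge> 0\<close> by (intro mult_left_mono)
      also have "\<dots> \<le> 2 * \<kappa> * (E * (1 + y0\<^sup>2))"
        using E \<open>\<kappa> \<ge> 0\<close> by (simp add: algebra_simps)
      finally have 1: "\<kappa> * v2 \<sigma>0 s0 y0 \<le> 2 * \<kappa> * (E * (1 + y0\<^sup>2))" .
      have "2 * \<bar>y0\<bar> \<le> 1 + y0\<^sup>2"
        using sum_squares_bound[of 1 "\<bar>y0\<bar>"] by simp
      then have "E * (2 * \<bar>y0\<bar>) \<le> E * (1 + y0\<^sup>2)"
        using E by (intro mult_left_mono) auto
      then have "\<bar>b \<sigma>0\<bar> * (E * (2 * \<bar>y0\<bar>)) \<le> \<bar>b \<sigma>0\<bar> * (E * (1 + y0\<^sup>2))"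
        by (rule mult_left_mono) simp
      moreover have "b \<sigma>0 * v1 \<sigma>0 s0 y0 \<le> \<bar>b \<sigma>0\<bar> * (E * (2 * \<bar>y0\<bar>))"
        unfolding space(1) using E abs_ge_self[of "b \<sigma>0 * (E * (2 * y0))"] by (simp add: abs_mult)
      ultimately have 2: "b \<sigma>0 * v1 \<sigma>0 s0 y0 \<le> \<bar>b \<sigma>0\<bar> * (E * (1 + y0\<^sup>2))"
        by linarith
      \<comment> \<open>The barrier does not depend on the spin, so comparing \<open>w\<close> at
        the two spins is comparing \<open>v\<close>.\<close>
      have "v (flip \<sigma>0) s0 y0 - v \<sigma>0 s0 y0 \<le> 0"
        using max[of s0 "flip \<sigma>0" y0] mem by (auto simp: w_def)
      then have 3: "\<gamma> * (v (flip \<sigma>0) s0 y0 - v \<sigma>0 s0 y0) \<le> 0"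
        using \<open>\<gamma> \<ge> 0\<close> by (simp add: mult_nonneg_nonpos)
      have "(2 * \<kappa> + \<bar>b \<sigma>0\<bar>) * (E * (1 + y0\<^sup>2)) < K * (E * (1 + y0\<^sup>2))"
        using E K by (intro mult_strict_right_mono mult_pos_pos) (auto simp: add_pos_nonneg)
      then show ?thesis
        using 1 2 3 unfolding D_def distrib_right by linarith
    qed
    \<comment> \<open>Since \<open>s0\<close> may be the final time \<open>t\<close>, only earlier
      times can contradict maximality.\<close>
    then obtain d where d: "d > 0" "\<And>h. 0 < h \<Longrightarrow> h < d \<Longrightarrow> w \<sigma>0 s0 y0 < w \<sigma>0 (s0 - h) y0"
      using DERIV_neg_dec_left[OF wt] by auto
    define h where "h = min d s0 / 2"
    have "h > 0" "h < d" "h < s0"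
      using d s0 by (auto simp: h_def min_def)
    then show False
      using d(2)[of h] max[of "s0 - h" \<sigma>0 y0] mem by auto
  qed
  define W where "W = exp (K * t) * (1 + y\<^sup>2)"
  have "W > 0"
    unfolding W_def by (intro mult_pos_pos add_pos_nonneg) auto
  have "v \<sigma> t y \<le> 0 + \<delta>" if "\<delta> > 0" for \<delta>
    using barrier[of "\<delta> / W" \<sigma> y] that \<open>W > 0\<close> unfolding W_def[symmetric] by simp
  then show ?thesis
    by (rule field_le_epsilon)
qed

section \<open>Uniqueness for the weak evolution equation\<close>

lemma lift_S_conv_single: "lift_S f = (\<lambda>p. 1 * single Plus f p + 1 * single Minus f p)"
proof
  fix p :: "real \<times> spin"
  show "lift_S f p = 1 * single Plus f p + 1 * single Minus f p"
    by (cases p; cases "snd p") (auto simp: lift_S_def single_def)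
qed

lemma lift_S_in_Cc_infty_S: "f \<in> Cc_infty \<Longrightarrow> lift_S f \<in> Cc_infty_S"
  by (simp add: lift_S_def Cc_infty_S_def)

text \<open>\<open>D\<close> is known only through linearity and size bounds, so its derivative
  along translates has to be read off from an estimate of the Taylor remainder. Steps up to 1
  suffice and keep all supports in one window.\<close>

lemma has_real_derivative_of_quadratic_remainder:
  fixes v :: "real \<Rightarrow> real"
  assumes "\<And>h. \<bar>h\<bar> \<le> 1 \<Longrightarrow> \<bar>v (y + h) - v y - h * d\<bar> \<le> C * h\<^sup>2"
  shows "(v has_real_derivative d) (at y)"
proof -
  have "((\<lambda>h. (v (y + h) - v y) / h - d) \<longlongrightarrow> 0) (at 0)"
  proof (rule Lim_null_comparison)
    show "\<forall>\<^sub>F h in at 0. norm ((v (y + h) - v y) / h - d) \<le> C * \<bar>h\<bar>"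
      unfolding eventually_at
    proof (intro exI[of _ 1] conjI ballI impI)
      fix h :: real
      assume h: "h \<noteq> 0 \<and> dist h 0 < 1"
      have "norm ((v (y + h) - v y) / h - d) = \<bar>v (y + h) - v y - h * d\<bar> / \<bar>h\<bar>"
        using h by (simp add: diff_divide_distrib abs_divide[symmetric] del: abs_divide)
      also have "\<dots> \<le> C * h\<^sup>2 / \<bar>h\<bar>"
        using assms[of h] h by (intro divide_right_mono) auto
      also have "\<dots> = C * \<bar>h\<bar>"
        using h by (cases "h > 0") (auto simp: power2_eq_square)
      finally show "norm ((v (y + h) - v y) / h - d) \<le> C * \<bar>h\<bar>" .
    qed simp
    show "((\<lambda>h. C * \<bar>h\<bar>) \<longlongrightarrow> 0) (at 0)"
      by (auto intro!: tendsto_eq_intros)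
  qed
  then show ?thesis
    unfolding DERIV_def using LIM_zero_iff by blast
qed

text \<open>Testing against the translates of a fixed test function turns a weak solution into a
  bounded classical solution of a parabolic system, to which the maximum principle applies.\<close>

lemma weak_solution_zero:
  fixes D :: "real \<Rightarrow> (real \<times> spin \<Rightarrow> real) \<Rightarrow> real"
  assumes "\<kappa> \<ge> 0" "\<gamma> \<ge> 0"
    and lin: "\<And>s f g a b. 0 \<le> s \<Longrightarrow> f \<in> Cc_infty_S \<Longrightarrow> g \<in> Cc_infty_S \<Longrightarrow>
      D s (\<lambda>p. a * f p + b * g p) = a * D s f + b * D s g"
    and bnd: "\<And>L. \<exists>C\<ge>0. \<forall>s\<ge>0. \<forall>f\<in>Cc_infty_S. \<forall>c m.
      (\<forall>x \<sigma>. L < \<bar>x - c\<bar> \<longrightarrow> f (x, \<sigma>) = 0) \<longrightarrow> (\<forall>p. \<bar>f p\<bar> \<le> m) \<longrightarrow> \<bar>D s f\<bar> \<le> C * m"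
    and deriv: "\<And>s f. 0 \<le> s \<Longrightarrow> f \<in> Cc_infty_S \<Longrightarrow>
      ((\<lambda>s. D s f) has_real_derivative D s (A_op \<kappa> lam \<gamma> f)) (at s within {0..})"
    and init: "\<And>f. f \<in> Cc_infty_S \<Longrightarrow> D 0 f = 0"
    and t: "t \<ge> 0" and f: "f \<in> Cc_infty"
  shows "D t (single \<sigma> f) = 0"
proof -
  \<comment> \<open>The translation \<open>y\<close> becomes the space variable of the parabolic
    system, and the spin its component index.\<close>
  define V where "V f \<sigma> s y = D s (single \<sigma> (\<lambda>x. f (x - y)))" for f \<sigma> s y
  have V_linear: "D s (single \<sigma> (\<lambda>x. a * f x + b * g x)) = a * D s (single \<sigma> f) + b * D s (single \<sigma> g)"
    if "0 \<le> s" "f \<in> Cc_infty" "g \<in> Cc_infty" for s \<sigma> a b f g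
  proof -
    have "single \<sigma> (\<lambda>x. a * f x + b * g x) = (\<lambda>p. a * single \<sigma> f p + b * single \<sigma> g p)"
      by (auto simp: single_def)
    then show ?thesis
      using lin that single_in_Cc_infty_S by simp
  qed
  have V_bound: "\<exists>C\<ge>0. \<forall>\<sigma> s y. 0 \<le> s \<longrightarrow> \<bar>V f \<sigma> s y\<bar> \<le> C" if f: "f \<in> Cc_infty" for f
  proof -
    obtain B where B: "\<And>x. B < \<bar>x\<bar> \<Longrightarrow> f x = 0"
      using f unfolding Cc_infty_iff by blast
    obtain m where m: "m \<ge> 0" "\<And>x. \<bar>f x\<bar> \<le> m"
      using Cc_infty_bounded[OF f] by blast
    obtain C where C: "C \<ge> 0" "\<And>s f c m. 0 \<le> s \<Longrightarrow> f \<in> Cc_infty_S \<Longrightarrow>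
        (\<forall>x \<sigma>. B < \<bar>x - c\<bar> \<longrightarrow> f (x, \<sigma>) = 0) \<Longrightarrow> (\<forall>p. \<bar>f p\<bar> \<le> m) \<Longrightarrow> \<bar>D s f\<bar> \<le> C * m"
      using bnd[of B] by blast
    have "\<bar>V f \<sigma> s y\<bar> \<le> C * m" if "0 \<le> s" for \<sigma> s y
      unfolding V_def
      by (rule C(2)[OF that, where c = y])
         (use f B m in \<open>auto simp: single_def intro!: single_in_Cc_infty_S[unfolded single_def] Cc_infty_shift\<close>)
    then show ?thesis
      using C m by (intro exI[of _ "C * m"]) auto
  qed
  have V_deriv: "(V f \<sigma> s has_real_derivative - V (deriv f) \<sigma> s y) (at y)"
    if f: "f \<in> Cc_infty" and s: "0 \<le> s" for f \<sigma> s y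
  proof -
    have f': "deriv f \<in> Cc_infty" and f'': "deriv (deriv f) \<in> Cc_infty" and sm: "smooth f"
      using f Cc_infty_deriv by (auto simp: Cc_infty_iff)
    obtain B where B: "\<And>x. B < \<bar>x\<bar> \<Longrightarrow> f x = 0"
      using f unfolding Cc_infty_iff by blast
    obtain m where m: "m \<ge> 0" "\<And>x. \<bar>deriv (deriv f) x\<bar> \<le> m"
      using Cc_infty_bounded[OF f''] by blast
    obtain C where C: "C \<ge> 0" "\<And>s f c m. 0 \<le> s \<Longrightarrow> f \<in> Cc_infty_S \<Longrightarrow>
        (\<forall>x \<sigma>. B + 1 < \<bar>x - c\<bar> \<longrightarrow> f (x, \<sigma>) = 0) \<Longrightarrow> (\<forall>p. \<bar>f p\<bar> \<le> m) \<Longrightarrow> \<bar>D s f\<bar> \<le> C * m"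
      \<comment> \<open>A shift by at most 1 moves the support by at most 1, so all remainders lie
        in a window of radius \<open>B + 1\<close> around \<open>y\<close>.\<close>
      using bnd[of "B + 1"] by blast
    show ?thesis
    proof (rule has_real_derivative_of_quadratic_remainder)
      fix h :: real assume h: "\<bar>h\<bar> \<le> 1"
      \<comment> \<open>The Taylor remainder of the translate in its shift parameter; the derivative
        term enters with a plus sign because the shift is subtracted from \<open>x\<close>.\<close>
      define r where "r = (\<lambda>x. 1 * (1 * f (x - (y + h)) + (- 1) * f (x - y)) + h * deriv f (x - y))"
      note sh = Cc_infty_shift[OF f] Cc_infty_shift[OF f']
      have r: "r \<in> Cc_infty"
        unfolding r_def by (intro Cc_infty_lincomb sh)
      have "D s (single \<sigma> r) = 1 * (1 * V f \<sigma> s (y + h) + (- 1) * V f \<sigma> s y) + h * V (deriv f) \<sigma> s y"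
        unfolding r_def V_def by (simp only: V_linear s sh Cc_infty_lincomb)
      moreover have "\<bar>D s (single \<sigma> r)\<bar> \<le> C * (m * h\<^sup>2)"
      proof (rule C(2)[OF s, where c = y])
        have "r x = 0" if "B + 1 < \<bar>x - y\<bar>" for x
        proof -
          have "B < \<bar>x - (y + h)\<bar>" "B < \<bar>x - y\<bar>"
            using that h by auto
          then show ?thesis
            by (simp add: r_def B deriv_zero_outside_support[of B f, OF B])
        qed
        then show "\<forall>x \<tau>. B + 1 < \<bar>x - y\<bar> \<longrightarrow> single \<sigma> r (x, \<tau>) = 0"
          by (auto simp: single_def)
        have "\<bar>r x\<bar> \<le> m * h\<^sup>2" for x
          using smooth_taylor_bound[OF sm m(2), of "x - y" "- h"] by (simp add: r_def algebra_simps)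
        then show "\<forall>p. \<bar>single \<sigma> r p\<bar> \<le> m * h\<^sup>2"
          using m(1) by (auto simp: single_def)
      qed (rule single_in_Cc_infty_S[OF r])
      ultimately show "\<bar>V f \<sigma> s (y + h) - V f \<sigma> s y - h * - V (deriv f) \<sigma> s y\<bar> \<le> (C * m) * h\<^sup>2"
        by (simp add: mult.assoc)
    qed
  qed
  have V_time: "((\<lambda>s. V f \<sigma> s y) has_real_derivative \<kappa> * V (deriv (deriv f)) \<sigma> s y
      + spin_val \<sigma> * lam * V (deriv f) \<sigma> s y + \<gamma> * (V f (flip \<sigma>) s y - V f \<sigma> s y)) (at s within {0..})"
    if f: "f \<in> Cc_infty" and s: "0 \<le> s" for f \<sigma> s y
  proof -
    have f': "deriv f \<in> Cc_infty" and f'': "deriv (deriv f) \<in> Cc_infty"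
      using f Cc_infty_deriv by auto
    have sh: "deriv (\<lambda>x. f (x - y)) = (\<lambda>x. deriv f (x - y))"
      "deriv (\<lambda>x. deriv f (x - y)) = (\<lambda>x. deriv (deriv f) (x - y))"
      using deriv_funpow_shift[of f 1 y] deriv_funpow_shift[of "deriv f" 1 y] f f' by (auto simp: Cc_infty_iff)
    have mem: "single \<tau> (\<lambda>x. f (x - y)) \<in> Cc_infty_S" "single \<tau> (\<lambda>x. deriv f (x - y)) \<in> Cc_infty_S"
      "single \<tau> (\<lambda>x. deriv (deriv f) (x - y)) \<in> Cc_infty_S" for \<tau>
      by (intro single_in_Cc_infty_S Cc_infty_shift f f' f'')+
    \<comment> \<open>Here \<open>A\<close> commutes with translations: by \<open>sh\<close> the
      derivatives of a translate are the translates of the derivatives.\<close>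
    have A: "D s (A_op \<kappa> lam \<gamma> (single \<sigma> (\<lambda>x. f (x - y)))) =
      1 * (\<kappa> * V (deriv (deriv f)) \<sigma> s y + spin_val \<sigma> * lam * V (deriv f) \<sigma> s y)
      + 1 * (\<gamma> * V f (flip \<sigma>) s y + (- \<gamma>) * V f \<sigma> s y)"
      unfolding A_op_single sh V_def by (simp only: lin s mem Cc_infty_S_lincomb)
    then show ?thesis
      using deriv[OF s mem(1)[of \<sigma>], unfolded A]
      by (simp add: V_def[of f] right_diff_distrib)
  qed
  have V_cont: "continuous_on ({0..} \<times> UNIV) (\<lambda>(s, y). V f \<sigma> s y)" if f: "f \<in> Cc_infty" for f \<sigma>
  proof -
    have f': "deriv f \<in> Cc_infty" and f'': "deriv (deriv f) \<in> Cc_infty"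
      using f Cc_infty_deriv by auto
    obtain C0 where C0: "C0 \<ge> 0" "\<And>\<sigma> s y. 0 \<le> s \<Longrightarrow> \<bar>V f \<sigma> s y\<bar> \<le> C0"
      using V_bound[OF f] by blast
    obtain C1 where C1: "C1 \<ge> 0" "\<And>\<sigma> s y. 0 \<le> s \<Longrightarrow> \<bar>V (deriv f) \<sigma> s y\<bar> \<le> C1"
      using V_bound[OF f'] by blast
    obtain C2 where C2: "C2 \<ge> 0" "\<And>\<sigma> s y. 0 \<le> s \<Longrightarrow> \<bar>V (deriv (deriv f)) \<sigma> s y\<bar> \<le> C2"
      using V_bound[OF f''] by blast
    \<comment> \<open>A bound for the right side of the evolution equation, hence a Lipschitz
      constant in time that is uniform in \<open>y\<close>. Together with the Lipschitz constant
      \<open>C1\<close> in space it yields joint continuity.\<close>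
    define L where "L = \<kappa> * C2 + \<bar>spin_val \<sigma> * lam\<bar> * C1 + \<gamma> * (C0 + C0)"
    have sp: "\<bar>V f \<sigma> s y - V f \<sigma> s z\<bar> \<le> C1 * \<bar>y - z\<bar>" if "0 \<le> s" for s y z
      using field_differentiable_bound[of UNIV "V f \<sigma> s" "\<lambda>y. - V (deriv f) \<sigma> s y" C1 y z]
        V_deriv[OF f that] C1(2)[OF that] by simp
    have tm: "\<bar>V f \<sigma> s y - V f \<sigma> r y\<bar> \<le> L * \<bar>s - r\<bar>" if "0 \<le> s" "0 \<le> r" for s r y
    proof -
      have "\<bar>\<kappa> * V (deriv (deriv f)) \<sigma> s y + spin_val \<sigma> * lam * V (deriv f) \<sigma> s y
          + \<gamma> * (V f (flip \<sigma>) s y - V f \<sigma> s y)\<bar> \<le> L" if "0 \<le> s" for s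
      proof -
        have "\<bar>\<kappa> * V (deriv (deriv f)) \<sigma> s y\<bar> \<le> \<kappa> * C2"
          using C2(2)[OF that] \<open>\<kappa> \<ge> 0\<close> by (simp add: abs_mult mult_left_mono)
        moreover have "\<bar>spin_val \<sigma> * lam * V (deriv f) \<sigma> s y\<bar> \<le> \<bar>spin_val \<sigma> * lam\<bar> * C1"
          unfolding abs_mult[of "spin_val \<sigma> * lam"] using C1(2)[OF that] by (simp add: mult_left_mono)
        moreover have "\<bar>\<gamma> * (V f (flip \<sigma>) s y - V f \<sigma> s y)\<bar> \<le> \<gamma> * (C0 + C0)"
          unfolding abs_mult using \<open>\<gamma> \<ge> 0\<close> C0(2)[OF that, of "flip \<sigma>" y] C0(2)[OF that, of \<sigma> y]
          by (simp add: mult_left_mono del: mult_2)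
        ultimately show ?thesis
          unfolding L_def by linarith
      qed
      then show ?thesis
        using field_differentiable_bound[OF _ V_time[OF f, of _ \<sigma> y], of L s r] that by simp
    qed
    have "L \<ge> 0"
      using C0(1) C1(1) C2(1) \<open>\<kappa> \<ge> 0\<close> \<open>\<gamma> \<ge> 0\<close> by (simp add: L_def)
    have "(L + C1)-lipschitz_on ({0..} \<times> UNIV) (\<lambda>(s, y). V f \<sigma> s y)"
    proof (rule lipschitz_onI)
      fix p q :: "real \<times> real" assume "p \<in> {0..} \<times> UNIV" "q \<in> {0..} \<times> UNIV"
      then obtain s y r z where p: "p = (s, y)" "q = (r, z)" "0 \<le> s" "0 \<le> r"
        by auto
      have "\<bar>V f \<sigma> s y - V f \<sigma> r z\<bar> \<le> L * \<bar>s - r\<bar> + C1 * \<bar>y - z\<bar>"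
        using tm[of s r y] sp[of r y z] p by simp
      also have "\<dots> \<le> L * dist p q + C1 * dist p q"
        using dist_fst_le[of p q] dist_snd_le[of p q] p \<open>L \<ge> 0\<close> C1(1)
        by (intro add_mono mult_left_mono) (auto simp: dist_real_def)
      finally show "dist (case p of (s, y) \<Rightarrow> V f \<sigma> s y) (case q of (s, y) \<Rightarrow> V f \<sigma> s y) \<le> (L + C1) * dist p q"
        by (simp add: p dist_real_def distrib_right)
    qed (use \<open>L \<ge> 0\<close> C1(1) in simp)
    then show ?thesis
      by (rule lipschitz_on_continuous_on)
  qed
  have nonpos: "D t (single \<sigma> f) \<le> 0" if f: "f \<in> Cc_infty" for f
  proof -
    have f': "deriv f \<in> Cc_infty"
      using f Cc_infty_deriv by auto
    obtain C where C: "\<And>\<sigma> s y. 0 \<le> s \<Longrightarrow> \<bar>V f \<sigma> s y\<bar> \<le> C"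
      using V_bound[OF f] by blast
    have "V f \<sigma> t 0 \<le> 0"
    \<comment> \<open>Each space derivative of \<open>V\<close> contributes a minus sign: the drift
      coefficient changes sign, the diffusion term does not.\<close>
    proof (rule spin_maximum_principle[of \<kappa> \<gamma> "V f" C "\<lambda>\<sigma> s y. - V (deriv f) \<sigma> s y"
          "\<lambda>\<sigma> s y. V (deriv (deriv f)) \<sigma> s y" "\<lambda>\<sigma>. - (spin_val \<sigma> * lam)"])
      show "V f \<sigma> s y \<le> C" if "0 \<le> s" for \<sigma> s y
        using C[OF that, of \<sigma> y] by simp
      show "((\<lambda>y. - V (deriv f) \<sigma> s y) has_real_derivative V (deriv (deriv f)) \<sigma> s y) (at y)"
        if "0 \<le> s" for \<sigma> s y
        using DERIV_minus[OF V_deriv[OF f' that, of \<sigma> y]] by simp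
      show "((\<lambda>s. V f \<sigma> s y) has_real_derivative \<kappa> * V (deriv (deriv f)) \<sigma> s y
          + - (spin_val \<sigma> * lam) * - V (deriv f) \<sigma> s y + \<gamma> * (V f (flip \<sigma>) s y - V f \<sigma> s y)) (at s)"
        if "0 < s" for \<sigma> s y
        using V_time[OF f, of s \<sigma> y] that at_within_interior[of s "{0..}"] by simp
      show "V f \<sigma> 0 y \<le> 0" for \<sigma> y
        unfolding V_def by (simp add: init single_in_Cc_infty_S Cc_infty_shift f)
    qed (use assms V_cont[OF f] V_deriv[OF f] in auto)
    then show ?thesis
      by (simp add: V_def)
  qed
  \<comment> \<open>The maximum principle gives one inequality only; applying it to
    \<open>- f\<close>, written as a linear combination, gives the other.\<close>
  have "D t (single \<sigma> (\<lambda>x. (- 1) * f x + 0 * f x)) \<le> 0"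
    by (intro nonpos Cc_infty_lincomb f)
  then have "- D t (single \<sigma> f) \<le> 0"
    unfolding V_linear[OF t f f] by simp
  then show ?thesis
    using nonpos[OF f] by simp
qed

section \<open>The two-time covariance of the fluctuation process\<close>

text \<open>The factor 4 comes from two spins and an interval of length
  \<open>2 * \<bar>L\<bar>\<close>. The absolute value allows a negative \<open>L\<close>, for which
  the support condition forces \<open>f = 0\<close>.\<close>

lemma pairing_self_le:
  assumes f: "f \<in> Cc_infty_S" and supp: "\<And>x \<sigma>. L < \<bar>x - c\<bar> \<Longrightarrow> f (x, \<sigma>) = 0"
    and m: "\<And>p. \<bar>f p\<bar> \<le> m"
  shows "pairing f f \<le> 4 * \<bar>L\<bar> * m\<^sup>2"
proof -
  have "(LINT x|lborel. f (x, \<sigma>) * f (x, \<sigma>)) \<le> 2 * \<bar>L\<bar> * m\<^sup>2" for \<sigma>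
  proof -
    have sq: "f (x, \<sigma>) * f (x, \<sigma>) \<le> m\<^sup>2" for x
      using power_mono[OF m[of "(x, \<sigma>)"] abs_ge_zero, of 2] by (simp add: power2_eq_square)
    have "(LINT x|lborel. f (x, \<sigma>) * f (x, \<sigma>)) \<le> (LINT x|lborel. m\<^sup>2 * indicator {c - \<bar>L\<bar>..c + \<bar>L\<bar>} x)"
    proof (rule integral_mono')
      show "integrable lborel (\<lambda>x. m\<^sup>2 * indicator {c - \<bar>L\<bar>..c + \<bar>L\<bar>} x)"
        by simp
      fix x
      show "f (x, \<sigma>) * f (x, \<sigma>) \<le> m\<^sup>2 * indicator {c - \<bar>L\<bar>..c + \<bar>L\<bar>} x"
        using supp[of x \<sigma>] sq[of x] by (cases "L < \<bar>x - c\<bar>") (auto simp: indicator_def)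
    qed (auto simp: zero_le_mult_iff)
    also have "\<dots> = 2 * \<bar>L\<bar> * m\<^sup>2"
      by simp
    finally show ?thesis .
  qed
  from add_mono[OF this[of Minus] this[of Plus]] show ?thesis
    by (simp add: pairing_def UNIV_spin)
qed

section \<open>Products of square-integrable random variables\<close>

lemma integrable_mult_of_squares:
  fixes X Z :: "'w \<Rightarrow> real"
  assumes [measurable]: "X \<in> borel_measurable M" "Z \<in> borel_measurable M"
    and "integrable M (\<lambda>w. (X w)\<^sup>2)" "integrable M (\<lambda>w. (Z w)\<^sup>2)"
  shows "integrable M (\<lambda>w. X w * Z w)"
proof (rule Bochner_Integration.integrable_bound[OF Bochner_Integration.integrable_add[OF assms(3,4)]])
  have "\<bar>X w * Z w\<bar> \<le> (X w)\<^sup>2 + (Z w)\<^sup>2" for w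
  proof -
    have "2 * (\<bar>X w\<bar> * \<bar>Z w\<bar>) \<le> (X w)\<^sup>2 + (Z w)\<^sup>2"
      using sum_squares_bound[of "\<bar>X w\<bar>" "\<bar>Z w\<bar>"] by (simp add: mult.assoc)
    moreover have "0 \<le> \<bar>X w\<bar> * \<bar>Z w\<bar>"
      by simp
    ultimately show ?thesis
      unfolding abs_mult by linarith
  qed
  then show "AE w in M. norm (X w * Z w) \<le> norm ((X w)\<^sup>2 + (Z w)\<^sup>2)"
    by simp
qed simp

text \<open>A bound by an inhomogeneous form of the Cauchy--Schwarz inequality that is linear in the
  size \<open>m\<close> of the first factor.\<close>

lemma integral_abs_mult_le:
  fixes X Z :: "'w \<Rightarrow> real"
  assumes [measurable]: "X \<in> borel_measurable M" "Z \<in> borel_measurable M"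
    and X2: "integrable M (\<lambda>w. (X w)\<^sup>2)" and Z2: "integrable M (\<lambda>w. (Z w)\<^sup>2)"
    and m: "m \<ge> 0" and le: "(LINT w|M. (X w)\<^sup>2) \<le> a * m\<^sup>2"
  shows "(LINT w|M. \<bar>X w * Z w\<bar>) \<le> (a + (LINT w|M. (Z w)\<^sup>2)) / 2 * m"
proof (cases "m = 0")
  case True
  have "(LINT w|M. (X w)\<^sup>2) = 0"
    using le True by (intro antisym) auto
  then have "AE w in M. (X w)\<^sup>2 = 0"
    using integral_nonneg_eq_0_iff_AE[OF X2] by simp
  then have "(LINT w|M. \<bar>X w * Z w\<bar>) = (LINT w|M. 0)"
    by (intro integral_cong_AE) auto
  then show ?thesis
    using True by simp
next
  case False
  then have m: "m > 0" using m by simp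
  have pw: "\<bar>X w * Z w\<bar> \<le> (X w)\<^sup>2 / (2 * m) + m / 2 * (Z w)\<^sup>2" for w
  proof -
    \<comment> \<open>The weight \<open>m\<close> balances the two squares: after division by
      \<open>2 * m\<close> the first has mean at most \<open>a * m / 2\<close>, so both terms are
      linear in \<open>m\<close>.\<close>
    have "2 * \<bar>X w\<bar> * (m * \<bar>Z w\<bar>) \<le> (X w)\<^sup>2 + m\<^sup>2 * (Z w)\<^sup>2"
      using sum_squares_bound[of "\<bar>X w\<bar>" "m * \<bar>Z w\<bar>"] by (simp add: power_mult_distrib)
    then show ?thesis
      using m by (simp add: abs_mult field_simps power2_eq_square)
  qed
  have "(LINT w|M. \<bar>X w * Z w\<bar>) \<le> (LINT w|M. (X w)\<^sup>2 / (2 * m) + m / 2 * (Z w)\<^sup>2)"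
    using X2 Z2 m by (intro integral_mono' pw) auto
  also have "\<dots> = (LINT w|M. (X w)\<^sup>2) / (2 * m) + m / 2 * (LINT w|M. (Z w)\<^sup>2)"
    using X2 Z2 by simp
  also have "\<dots> \<le> a * m\<^sup>2 / (2 * m) + m / 2 * (LINT w|M. (Z w)\<^sup>2)"
    using le m by (intro add_right_mono divide_right_mono) auto
  also have "\<dots> = (a + (LINT w|M. (Z w)\<^sup>2)) / 2 * m"
    using m by (simp add: field_simps power2_eq_square)
  finally show ?thesis .
qed

lemma centered_normal_square_integrable:
  assumes "centered_normal M X"
  shows "integrable M (\<lambda>w. (X w)\<^sup>2)"
proof -
  have [measurable]: "X \<in> borel_measurable M"
    using assms by (simp add: centered_normal_def)
  consider "AE w in M. X w = 0" | s where "s > 0" "distributed M lborel X (normal_density 0 s)"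
    using assms by (auto simp: centered_normal_def)
  then show ?thesis
  proof cases
    case 1
    then have "integrable M (\<lambda>w. (X w)\<^sup>2) = integrable M (\<lambda>w. 0 :: real)"
      by (intro integrable_cong_AE) auto
    then show ?thesis by simp
  next
    case 2
    have "integrable lborel (\<lambda>x. normal_density 0 s x * x\<^sup>2)"
      using integrable_normal_moment[of s 0 2] 2(1) by (simp only: diff_0_right)
    then show ?thesis
      using distributed_integrable[OF 2(2), of "\<lambda>x. x\<^sup>2"] by simp
  qed
qed

section \<open>Moments and measurability of the stationary solution\<close>

locale stationary_spde_solution = prob_space M for M :: "'w measure" +
  fixes \<kappa> lam \<gamma> \<rho> :: real
    and Y :: "real \<Rightarrow> 'w \<Rightarrow> (real \<times> spin \<Rightarrow> real) \<Rightarrow> real"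
  assumes \<rho>_nonneg: "\<rho> \<ge> 0"
    and dual: "dual_process M Y"
    and stationary: "stationary_process M Y"
    and gaussian: "centered_gaussian_process M Y"
    and covariance: "\<And>f g. f \<in> Cc_infty_S \<Longrightarrow> g \<in> Cc_infty_S \<Longrightarrow>
           (LINT w|M. Y 0 w f * Y 0 w g) = \<rho> * pairing f g"
    and spde: "solves_SPDE \<kappa> lam \<gamma> \<rho> M Y"
begin

lemma Y_measurable: "0 \<le> s \<Longrightarrow> f \<in> Cc_infty_S \<Longrightarrow> (\<lambda>w. Y s w f) \<in> borel_measurable M"
  using dual by (simp add: dual_process_def)

lemma Y_lincomb:
  assumes "0 \<le> s" "w \<in> space M" "f \<in> Cc_infty_S" "g \<in> Cc_infty_S"
  shows "Y s w (\<lambda>p. a * f p + b * g p) = a * Y s w f + b * Y s w g"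
  using dual assms unfolding dual_process_def dual_Cc_infty_S_def by blast

lemma Y_square_integrable:
  assumes "0 \<le> s" "f \<in> Cc_infty_S"
  shows "integrable M (\<lambda>w. (Y s w f)\<^sup>2)"
proof -
  have "\<forall>(n::nat) t \<phi> a. (\<forall>i<n. t i \<ge> 0 \<and> \<phi> i \<in> Cc_infty_S) \<longrightarrow>
        centered_normal M (\<lambda>w. \<Sum>i<n. a i * Y (t i) w (\<phi> i))"
    using gaussian by (simp add: centered_gaussian_process_def)
  from this[rule_format, of 1 "\<lambda>_. s" "\<lambda>_. f" "\<lambda>_. 1"] assms
  have "centered_normal M (\<lambda>w. Y s w f)"
    by simp
  then show ?thesis
    by (rule centered_normal_square_integrable)
qed

text \<open>Stationarity with one time and one test function carries the covariance at time 0 to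
  time \<open>s\<close>; this makes all later estimates uniform in time.\<close>

lemma Y_second_moment:
  assumes s: "0 \<le> s" and f: "f \<in> Cc_infty_S"
  shows "(LINT w|M. (Y s w f)\<^sup>2) = \<rho> * pairing f f"
proof -
  let ?P = "PiM {..<1::nat} (\<lambda>_. borel :: real measure)"
  have eq: "distr M ?P (\<lambda>w. \<lambda>i\<in>{..<1}. Y (0 + s) w f) = distr M ?P (\<lambda>w. \<lambda>i\<in>{..<1}. Y 0 w f)"
    using stationary[unfolded stationary_process_def, rule_format, OF s, of 1 "\<lambda>_. 0" "\<lambda>_. f"] f
    by simp
  have meas: "(\<lambda>w. \<lambda>i\<in>{..<1}. Y r w f) \<in> measurable M ?P" if "0 \<le> r" for r
    using Y_measurable[OF that f] by (intro measurable_restrict) auto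
  have sq: "(\<lambda>x. (x 0)\<^sup>2) \<in> borel_measurable ?P"
    by measurable
  have "(LINT w|M. (Y r w f)\<^sup>2) = integral\<^sup>L (distr M ?P (\<lambda>w. \<lambda>i\<in>{..<1}. Y r w f)) (\<lambda>x. (x 0)\<^sup>2)"
    if "0 \<le> r" for r
    unfolding integral_distr[OF meas[OF that] sq] by simp
  from this[of s] this[of 0] s eq have "(LINT w|M. (Y s w f)\<^sup>2) = (LINT w|M. (Y 0 w f)\<^sup>2)"
    by simp
  then show ?thesis
    using covariance[OF f f] by (simp add: power2_eq_square)
qed

text \<open>Freezing the process at its initial value for negative times extends joint measurability
  to the whole line, as needed for Fubini with \<open>lborel\<close>.\<close>

lemma Y_jointly_measurable:
  assumes "f \<in> Cc_infty_S"
  shows "(\<lambda>(s, w). Y (max 0 s) w f) \<in> borel_measurable (borel \<Otimes>\<^sub>M M)"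
proof -
  have "(\<lambda>(s, w). Y s w f) \<in> borel_measurable (restrict_space borel {0..} \<Otimes>\<^sub>M M)"
    using dual assms by (simp add: dual_process_def)
  then have Y: "(\<lambda>p. Y (fst p) (snd p) f) \<in> borel_measurable (restrict_space borel {0..} \<Otimes>\<^sub>M M)"
    by (simp add: case_prod_beta)
  have "(\<lambda>p. (max 0 (fst p), snd p)) \<in> (borel \<Otimes>\<^sub>M M) \<rightarrow>\<^sub>M (restrict_space borel {0::real..} \<Otimes>\<^sub>M M)"
    by (intro measurable_Pair measurable_restrict_space2) auto
  from measurable_compose[OF this Y] show ?thesis
    by (simp add: case_prod_beta)
qed

lemma subalgebra_natural_filtration:
  assumes "0 \<le> s"
  shows "subalgebra M (natural_filtration M Y s)"
  unfolding subalgebra_def natural_filtration_def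
proof (intro conjI)
  let ?G = "{(\<lambda>w. Y r w \<phi>) -` B \<inter> space M | r \<phi> B. 0 \<le> r \<and> r \<le> s \<and> \<phi> \<in> Cc_infty_S \<and> B \<in> sets borel}"
  have sub: "?G \<subseteq> sets M"
    using measurable_sets[OF Y_measurable] by blast
  have "?G \<subseteq> Pow (space M)"
    by blast
  then show "sets (sigma (space M) ?G) \<subseteq> sets M"
    using sets.sigma_sets_subset[OF sub] by (simp only: sets_measure_of)
qed (simp add: space_measure_of_conv)

lemma Y_0_measurable_filtration:
  assumes "f \<in> Cc_infty_S"
  shows "(\<lambda>w. Y 0 w f) \<in> borel_measurable (natural_filtration M Y 0)"
proof (rule measurableI)
  fix B :: "real set" assume "B \<in> sets borel"
  then show "(\<lambda>w. Y 0 w f) -` B \<inter> space (natural_filtration M Y 0) \<in> sets (natural_filtration M Y 0)"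
    unfolding natural_filtration_def using assms
    by (subst space_measure_of_conv, intro in_measure_of) auto
qed simp

section \<open>Correlation with an observable of time 0\<close>

context
  fixes G :: "'w \<Rightarrow> real"
  assumes G_filtration: "G \<in> borel_measurable (natural_filtration M Y 0)"
    and G_square: "integrable M (\<lambda>w. (G w)\<^sup>2)"
begin

text \<open>Measurability of \<open>G\<close> at time 0 removes the martingale part of
  \<open>Y\<close>, and its square integrability makes the products integrable. In the application
  \<open>G\<close> is the total density at time 0 tested with \<open>\<psi>\<close>.\<close>

definition corr :: "real \<Rightarrow> (real \<times> spin \<Rightarrow> real) \<Rightarrow> real" where
  "corr s f = (LINT w|M. Y s w f * G w)"

lemma G_measurable[measurable]: "G \<in> borel_measurable M"
  using measurable_from_subalg[OF subalgebra_natural_filtration G_filtration] by simp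

lemma integrable_Y_G: "0 \<le> s \<Longrightarrow> f \<in> Cc_infty_S \<Longrightarrow> integrable M (\<lambda>w. Y s w f * G w)"
  by (intro integrable_mult_of_squares Y_measurable Y_square_integrable G_measurable G_square)

lemma corr_lincomb:
  assumes "0 \<le> s" "f \<in> Cc_infty_S" "g \<in> Cc_infty_S"
  shows "corr s (\<lambda>p. a * f p + b * g p) = a * corr s f + b * corr s g"
proof -
  have "corr s (\<lambda>p. a * f p + b * g p) = (LINT w|M. a * (Y s w f * G w) + b * (Y s w g * G w))"
    unfolding corr_def
    by (intro Bochner_Integration.integral_cong refl) (simp add: Y_lincomb assms algebra_simps)
  then show ?thesis
    using assms by (simp add: corr_def integrable_Y_G)
qed

lemma abs_corr_le: "\<bar>corr s f\<bar> \<le> (LINT w|M. \<bar>Y s w f * G w\<bar>)"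
  unfolding corr_def by (rule integral_abs_bound)

text \<open>The second moment of \<open>Y s w f\<close> is \<open>\<rho> * pairing f f\<close>, at
  most \<open>\<rho> * 4 * \<bar>L\<bar> * m\<^sup>2\<close> by the support condition. The absolute
  value stays inside the expectation because Fubini will need it there.\<close>

lemma corr_abs_bound:
  "\<exists>C\<ge>0. \<forall>s\<ge>0. \<forall>f\<in>Cc_infty_S. \<forall>c m. (\<forall>x \<sigma>. L < \<bar>x - c\<bar> \<longrightarrow> f (x, \<sigma>) = 0) \<longrightarrow>
     (\<forall>p. \<bar>f p\<bar> \<le> m) \<longrightarrow> (LINT w|M. \<bar>Y s w f * G w\<bar>) \<le> C * m"
proof (intro exI[of _ "(\<rho> * (4 * \<bar>L\<bar>) + (LINT w|M. (G w)\<^sup>2)) / 2"] conjI allI ballI impI)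
  show "0 \<le> (\<rho> * (4 * \<bar>L\<bar>) + (LINT w|M. (G w)\<^sup>2)) / 2"
    using \<rho>_nonneg by simp
next
  fix s c m :: real and f
  assume s: "0 \<le> s" and f: "f \<in> Cc_infty_S"
    and supp: "\<forall>x \<sigma>. L < \<bar>x - c\<bar> \<longrightarrow> f (x, \<sigma>) = 0" and m: "\<forall>p. \<bar>f p\<bar> \<le> m"
  have "m \<ge> 0"
    using m abs_ge_zero order_trans by blast
  moreover have "\<rho> * pairing f f \<le> \<rho> * (4 * \<bar>L\<bar> * m\<^sup>2)"
    using supp m by (intro mult_left_mono \<rho>_nonneg pairing_self_le[OF f, of L c]) auto
  ultimately show "(LINT w|M. \<bar>Y s w f * G w\<bar>) \<le> (\<rho> * (4 * \<bar>L\<bar>) + (LINT w|M. (G w)\<^sup>2)) / 2 * m"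
    by (intro integral_abs_mult_le Y_measurable Y_square_integrable G_measurable G_square s f)
       (auto simp: Y_second_moment s f mult.assoc)
qed

lemma corr_bound:
  "\<exists>C\<ge>0. \<forall>s\<ge>0. \<forall>f\<in>Cc_infty_S. \<forall>c m. (\<forall>x \<sigma>. L < \<bar>x - c\<bar> \<longrightarrow> f (x, \<sigma>) = 0) \<longrightarrow>
     (\<forall>p. \<bar>f p\<bar> \<le> m) \<longrightarrow> \<bar>corr s f\<bar> \<le> C * m"
proof -
  obtain C where "C \<ge> 0" and C: "\<And>s f c m. 0 \<le> s \<Longrightarrow> f \<in> Cc_infty_S \<Longrightarrow>
      (\<forall>x \<sigma>. L < \<bar>x - c\<bar> \<longrightarrow> f (x, \<sigma>) = 0) \<Longrightarrow> (\<forall>p. \<bar>f p\<bar> \<le> m) \<Longrightarrow>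
      (LINT w|M. \<bar>Y s w f * G w\<bar>) \<le> C * m"
    using corr_abs_bound[of L] by blast
  show ?thesis
    by (intro exI[of _ C] conjI allI ballI impI order_trans[OF abs_corr_le] \<open>C \<ge> 0\<close>)
      (rule C; assumption)
qed

text \<open>Multiply the martingale by \<open>G\<close> and take expectations: conditioning on time
  0 gives zero, since the martingale starts at zero. Fubini then exchanges the expectation with the
  time integral.\<close>

lemma corr_integral_equation:
  assumes t: "0 \<le> t" and f: "f \<in> Cc_infty_S"
  shows "set_integrable lborel {0..t} (\<lambda>s. corr s (A_op \<kappa> lam \<gamma> f))"
    and "corr t f = corr 0 f + (LINT s:{0..t}|lborel. corr s (A_op \<kappa> lam \<gamma> f))"
proof -
  interpret pair_sigma_finite lborel M ..
  define g where "g = A_op \<kappa> lam \<gamma> f"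
  have g: "g \<in> Cc_infty_S"
    unfolding g_def by (rule A_op_in_Cc_infty_S[OF f])
  obtain B where B: "\<And>x \<sigma>. B < \<bar>x\<bar> \<Longrightarrow> g (x, \<sigma>) = 0"
    using Cc_infty_S_support[OF g] by blast
  obtain m where m: "m \<ge> 0" "\<And>p. \<bar>g p\<bar> \<le> m"
    using Cc_infty_S_bounded[OF g] by blast
  obtain C where C: "C \<ge> 0" "\<And>s. 0 \<le> s \<Longrightarrow> (LINT w|M. \<bar>Y s w g * G w\<bar>) \<le> C * m"
  proof -
    have "\<forall>x \<sigma>. B < \<bar>x - 0\<bar> \<longrightarrow> g (x, \<sigma>) = 0" "\<forall>p. \<bar>g p\<bar> \<le> m"
      using B m by auto
    then show ?thesis
      using corr_abs_bound[of B] g that by blast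
  qed
  \<comment> \<open>On \<open>{0..t}\<close> the maximum has no effect and elsewhere the indicator
    vanishes, so \<open>h\<close> is the true integrand in a form measurable on the whole product
    space.\<close>
  define h where "h = (\<lambda>s w. indicator {0..t} s * (Y (max 0 s) w g * G w))"
  have h_meas: "(\<lambda>(s, w). h s w) \<in> borel_measurable (lborel \<Otimes>\<^sub>M M)"
  proof -
    note [measurable] = Y_jointly_measurable[OF g]
    have "(\<lambda>p. (\<lambda>(s, w). Y (max 0 s) w g) p * G (snd p)) \<in> borel_measurable (borel \<Otimes>\<^sub>M M)"
      by measurable
    then have "(\<lambda>p. indicator {0..t} (fst p) * ((\<lambda>(s, w). Y (max 0 s) w g) p * G (snd p))) \<in> borel_measurable (borel \<Otimes>\<^sub>M M)"
      by measurable
    moreover have "(borel \<Otimes>\<^sub>M M :: (real \<times> 'w) measure) \<rightarrow>\<^sub>M borel = (lborel \<Otimes>\<^sub>M M) \<rightarrow>\<^sub>M (borel :: real measure)"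
      by (intro measurable_cong_sets sets_pair_measure_cong) auto
    ultimately show ?thesis
      by (simp add: h_def case_prod_beta)
  qed
  have h_int: "integrable (lborel \<Otimes>\<^sub>M M) (\<lambda>(s, w). h s w)"
  proof (rule Fubini_integrable[OF h_meas])
    show "AE s in lborel. integrable M (\<lambda>w. case (s, w) of (s, w) \<Rightarrow> h s w)"
      using integrable_Y_G[OF _ g] by (simp add: h_def)
    show "integrable lborel (\<lambda>s. LINT w|M. norm (case (s, w) of (s, w) \<Rightarrow> h s w))"
    proof (rule Bochner_Integration.integrable_bound)
      show "integrable lborel (\<lambda>s. (C * m) * indicator {0..t} s :: real)"
        by (intro integrable_mult_right integrable_real_indicator) (auto simp: emeasure_lborel_Icc_eq)
      show "(\<lambda>s. LINT w|M. norm (case (s, w) of (s, w) \<Rightarrow> h s w)) \<in> borel_measurable lborel"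
        using h_meas by measurable
      show "AE s in lborel. norm (LINT w|M. norm (case (s, w) of (s, w) \<Rightarrow> h s w)) \<le> norm ((C * m) * indicator {0..t} s :: real)"
        using C m by (auto simp: h_def indicator_def abs_mult max_def)
    qed
  qed
  have h_corr: "(LINT w|M. h s w) = indicator {0..t} s *\<^sub>R corr s g" for s
    by (auto simp: h_def corr_def indicator_def max_def)
  show "set_integrable lborel {0..t} (\<lambda>s. corr s (A_op \<kappa> lam \<gamma> f))"
    using integrable_fst'[OF h_int] by (simp add: set_integrable_def h_corr g_def)
  have mart: "martingale M (natural_filtration M Y) (Mart \<kappa> lam \<gamma> Y f)"
    and mart2: "martingale M (natural_filtration M Y) (\<lambda>t w. (Mart \<kappa> lam \<gamma> Y f t w)\<^sup>2
             - 2 * t * \<kappa> * \<rho> * pairing (dx f) (dx f) - 2 * t * \<rho> * pairing f (Sigma_op \<gamma> f))"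
    using spde f by (auto simp: solves_SPDE_def)
  define N where "N = Mart \<kappa> lam \<gamma> Y f t"
  have N: "integrable M N"
    using mart t by (auto simp: martingale_def N_def)
  \<comment> \<open>The quadratic martingale is integrable and its compensator is deterministic.
    Adding the compensator back puts \<open>N\<close> in L2, so \<open>G * N\<close> is integrable
    and can be conditioned.\<close>
  have "integrable M (\<lambda>w. (N w)\<^sup>2 - 2 * t * \<kappa> * \<rho> * pairing (dx f) (dx f) - 2 * t * \<rho> * pairing f (Sigma_op \<gamma> f))"
    using mart2 t by (auto simp: martingale_def N_def)
  then have "integrable M (\<lambda>w. ((N w)\<^sup>2 - 2 * t * \<kappa> * \<rho> * pairing (dx f) (dx f) - 2 * t * \<rho> * pairing f (Sigma_op \<gamma> f))
      + (2 * t * \<kappa> * \<rho> * pairing (dx f) (dx f) + 2 * t * \<rho> * pairing f (Sigma_op \<gamma> f)))"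
    by (intro Bochner_Integration.integrable_add) auto
  then have "integrable M (\<lambda>w. (N w)\<^sup>2)"
    by (simp add: algebra_simps)
  then have GN: "integrable M (\<lambda>w. G w * N w)"
    using N by (intro integrable_mult_of_squares G_measurable G_square) auto
  have "(LINT w|M. G w * N w) = 0"
  proof -
    interpret sub: sigma_finite_subalgebra M "natural_filtration M Y 0"
      by (intro finite_measure_subalgebra_is_sigma_finite finite_measure_subalgebra.intro
          finite_measure_subalgebra_axioms.intro subalgebra_natural_filtration finite_measure_axioms) simp
    have "AE w in M. real_cond_exp M (natural_filtration M Y 0) N w = Mart \<kappa> lam \<gamma> Y f 0 w"
      using mart t by (auto simp: martingale_def N_def)
    moreover have "Mart \<kappa> lam \<gamma> Y f 0 w = 0" for w
    proof -
      have "AE s in lborel. indicator {0..0::real} s *\<^sub>R Y s w (A_op \<kappa> lam \<gamma> f) = 0"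
        using AE_lborel_singleton[of 0] by eventually_elim (simp add: indicator_def)
      then show ?thesis
        unfolding Mart_def set_lebesgue_integral_def by (simp only: integral_eq_zero_AE diff_self)
    qed
    ultimately have "AE w in M. G w * real_cond_exp M (natural_filtration M Y 0) N w = 0"
      by auto
    then have "(LINT w|M. G w * real_cond_exp M (natural_filtration M Y 0) N w) = (LINT w|M. 0)"
      by (intro integral_cong_AE) auto
    then show ?thesis
      using sub.real_cond_exp_intg(2)[OF GN G_filtration borel_measurable_integrable[OF N]] by simp
  qed
  moreover have "(LINT w|M. G w * N w) = (LINT w|M. Y t w f * G w - Y 0 w f * G w - (LINT s|lborel. h s w))"
  proof (intro Bochner_Integration.integral_cong refl)
    fix w
    have "(LINT s|lborel. h s w) = (LINT s|lborel. (indicator {0..t} s *\<^sub>R Y s w g) * G w)"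
      by (intro Bochner_Integration.integral_cong) (auto simp: h_def indicator_def max_def)
    then show "G w * N w = Y t w f * G w - Y 0 w f * G w - (LINT s|lborel. h s w)"
      by (simp add: N_def Mart_def set_lebesgue_integral_def g_def algebra_simps)
  qed
  moreover have "\<dots> = corr t f - corr 0 f - (LINT w|M. (LINT s|lborel. h s w))"
    using integrable_snd[OF h_int] integrable_Y_G f t by (simp add: corr_def)
  moreover have "(LINT w|M. (LINT s|lborel. h s w)) = (LINT s:{0..t}|lborel. corr s g)"
    using Fubini_integral[OF h_int] by (simp add: set_lebesgue_integral_def h_corr)
  ultimately show "corr t f = corr 0 f + (LINT s:{0..t}|lborel. corr s (A_op \<kappa> lam \<gamma> f))"
    by (simp add: g_def)
qed

lemma corr_eq_integral:
  assumes t: "0 \<le> t" and f: "f \<in> Cc_infty_S"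
  shows "(\<lambda>s. corr s (A_op \<kappa> lam \<gamma> f)) integrable_on {0..t}"
    and "corr t f = corr 0 f + integral {0..t} (\<lambda>s. corr s (A_op \<kappa> lam \<gamma> f))"
  using corr_integral_equation[OF assms] set_borel_integral_eq_integral by auto

text \<open>An indefinite integral is continuous. Applied to
  \<open>A_op \<kappa> lam \<gamma> f\<close>, again a test function, this makes the integrand of
  the integral equation continuous, and the fundamental theorem of calculus gives a classical
  derivative.\<close>

lemma corr_continuous:
  assumes f: "f \<in> Cc_infty_S"
  shows "continuous_on {0..t} (\<lambda>s. corr s f)"
proof (cases "0 \<le> t")
  case True
  have "continuous_on {0..t} (\<lambda>r. corr 0 f + integral {0..r} (\<lambda>s. corr s (A_op \<kappa> lam \<gamma> f)))"
    by (intro continuous_intros indefinite_integral_continuous_1 corr_eq_integral(1)[OF True f])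
  then show ?thesis
    by (rule continuous_on_eq) (rule corr_eq_integral(2)[OF _ f, symmetric], simp)
qed simp

lemma corr_deriv:
  assumes s: "0 \<le> s" and f: "f \<in> Cc_infty_S"
  shows "((\<lambda>s. corr s f) has_real_derivative corr s (A_op \<kappa> lam \<gamma> f)) (at s within {0..})"
proof -
  have "((\<lambda>r. corr 0 f + integral {0..r} (\<lambda>s. corr s (A_op \<kappa> lam \<gamma> f)))
      has_vector_derivative 0 + corr s (A_op \<kappa> lam \<gamma> f)) (at s within {0..s + 1})"
    using s by (intro has_vector_derivative_add has_vector_derivative_const
        integral_has_vector_derivative corr_continuous A_op_in_Cc_infty_S f) auto
  then have "((\<lambda>s. corr s f) has_vector_derivative corr s (A_op \<kappa> lam \<gamma> f)) (at s within {0..s + 1})"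
    unfolding add_0_left
    by (rule has_vector_derivative_transform[rotated 2]) (use s in \<open>auto intro: corr_eq_integral(2) f\<close>)
  \<comment> \<open>Ending the interval at \<open>s + 1\<close> keeps \<open>s\<close> off its right
    end, so both filters agree, also for \<open>s = 0\<close>.\<close>
  moreover have "at s within {0..s + 1} = at s within {0..}"
    by (rule at_within_nhd[of s "{..<s + 1}"]) auto
  ultimately show ?thesis
    by (simp add: has_real_derivative_iff_has_vector_derivative)
qed

end

end

section \<open>The Markov semigroup\<close>

lemma Cc_infty_in_C0:
  assumes "f \<in> Cc_infty"
  shows "continuous_on UNIV f" "(f \<longlongrightarrow> 0) at_infinity"
proof -
  show "continuous_on UNIV f"
    using assms by (simp add: Cc_infty_iff smooth_continuous_on)
  obtain B where B: "\<And>x. B < \<bar>x\<bar> \<Longrightarrow> f x = 0"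
    using assms unfolding Cc_infty_iff by blast
  have "\<forall>\<^sub>F x in at_infinity. f x = 0"
    unfolding eventually_at_infinity by (intro exI[of _ "B + 1"]) (auto intro!: B)
  then show "(f \<longlongrightarrow> 0) at_infinity"
    by (rule tendsto_eventually)
qed

section \<open>Functions vanishing at infinity and their pairing with a test function\<close>

lemma Cc_infty_S_subset_C0_S: "f \<in> Cc_infty_S \<Longrightarrow> f \<in> C0_S"
  using Cc_infty_in_C0 by (simp add: Cc_infty_S_def C0_S_def)

lemma C0_S_lincomb:
  assumes "f \<in> C0_S" "g \<in> C0_S"
  shows "(\<lambda>p. a * f p + b * g p) \<in> C0_S"
proof -
  have "((\<lambda>x. a * f (x, \<sigma>) + b * g (x, \<sigma>)) \<longlongrightarrow> a * 0 + b * 0) at_infinity" for \<sigma>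
    using assms unfolding C0_S_def by (intro tendsto_intros) auto
  then show ?thesis
    using assms unfolding C0_S_def by (auto intro!: continuous_intros)
qed

lemma C0_S_positive_part:
  assumes "f \<in> C0_S"
  shows "(\<lambda>p. max 0 (c * f p)) \<in> C0_S"
proof -
  have "((\<lambda>x. max 0 (c * f (x, \<sigma>))) \<longlongrightarrow> max 0 (c * 0)) at_infinity" for \<sigma>
    using assms unfolding C0_S_def by (intro tendsto_intros) auto
  then show ?thesis
    using assms unfolding C0_S_def by (auto intro!: continuous_intros)
qed

text \<open>A function in \<open>C0_S\<close> need not be integrable; the compact support of
  \<open>\<psi>\<close> is what gives the pairing with \<open>P t f\<close> a meaning.\<close>

lemma pairing_integrable:
  assumes "f \<in> C0_S" "\<psi> \<in> Cc_infty"
  shows "integrable lborel (\<lambda>x. f (x, \<sigma>) * \<psi> x)"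
proof -
  obtain B where B: "\<And>x. B < \<bar>x\<bar> \<Longrightarrow> \<psi> x = 0"
    using assms unfolding Cc_infty_iff by blast
  have "continuous_on {-B..B} (\<lambda>x. f (x, \<sigma>))"
    using assms(1) by (auto simp: C0_S_def intro: continuous_on_subset)
  then have "set_integrable lborel {-B..B} (\<lambda>x. f (x, \<sigma>) * \<psi> x)"
    using assms unfolding set_integrable_def
    by (intro borel_integrable_compact continuous_on_mult) (auto simp: Cc_infty_iff smooth_continuous_on)
  moreover have "(\<lambda>x. indicator {-B..B} x *\<^sub>R (f (x, \<sigma>) * \<psi> x)) = (\<lambda>x. f (x, \<sigma>) * \<psi> x)"
    using B by (force simp: fun_eq_iff indicator_def)
  ultimately show ?thesis
    by (simp add: set_integrable_def)
qed

lemma pairing_lincomb: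
  assumes "f \<in> C0_S" "g \<in> C0_S" "\<psi> \<in> Cc_infty"
  shows "pairing (\<lambda>p. a * f p + b * g p) (lift_S \<psi>) = a * pairing f (lift_S \<psi>) + b * pairing g (lift_S \<psi>)"
proof -
  have "(LINT x|lborel. (a * f (x, \<sigma>) + b * g (x, \<sigma>)) * \<psi> x)
      = a * (LINT x|lborel. f (x, \<sigma>) * \<psi> x) + b * (LINT x|lborel. g (x, \<sigma>) * \<psi> x)" for \<sigma>
  proof -
    have "(LINT x|lborel. (a * f (x, \<sigma>) + b * g (x, \<sigma>)) * \<psi> x)
        = (LINT x|lborel. a * (f (x, \<sigma>) * \<psi> x) + b * (g (x, \<sigma>) * \<psi> x))"
      by (simp add: algebra_simps)
    then show ?thesis
      using pairing_integrable[OF assms(1,3)] pairing_integrable[OF assms(2,3)] by simp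
  qed
  then show ?thesis
    by (simp add: pairing_def lift_S_def UNIV_spin algebra_simps)
qed

lemma pairing_abs_le:
  assumes "f \<in> C0_S" "\<psi> \<in> Cc_infty" "\<And>p. \<bar>f p\<bar> \<le> m"
  shows "\<bar>pairing f (lift_S \<psi>)\<bar> \<le> 2 * (LINT x|lborel. \<bar>\<psi> x\<bar>) * m"
proof -
  have bound: "\<bar>LINT x|lborel. f (x, \<sigma>) * \<psi> x\<bar> \<le> m * (LINT x|lborel. \<bar>\<psi> x\<bar>)" for \<sigma>
  proof -
    have "\<bar>LINT x|lborel. f (x, \<sigma>) * \<psi> x\<bar> \<le> (LINT x|lborel. \<bar>f (x, \<sigma>) * \<psi> x\<bar>)"
      by (rule integral_abs_bound)
    also have "\<dots> \<le> (LINT x|lborel. m * \<bar>\<psi> x\<bar>)"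
      using integrable_abs[OF pairing_integrable[OF assms(1,2)]] integrable_abs[OF Cc_infty_integrable[OF assms(2)]]
      by (intro integral_mono integrable_mult_right) (auto simp: abs_mult intro!: mult_right_mono assms(3))
    finally show ?thesis
      by simp
  qed
  have "\<bar>pairing f (lift_S \<psi>)\<bar> \<le> \<bar>LINT x|lborel. f (x, Minus) * \<psi> x\<bar> + \<bar>LINT x|lborel. f (x, Plus) * \<psi> x\<bar>"
    by (simp add: pairing_def lift_S_def UNIV_spin abs_triangle_ineq)
  also have "\<dots> \<le> m * (LINT x|lborel. \<bar>\<psi> x\<bar>) + m * (LINT x|lborel. \<bar>\<psi> x\<bar>)"
    by (intro add_mono bound)
  finally show ?thesis
    by (simp add: mult_ac)
qed

section \<open>Contraction and time derivative of the semigroup\<close>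

context
  fixes P :: "real \<Rightarrow> (real \<times> spin \<Rightarrow> real) \<Rightarrow> real \<times> spin \<Rightarrow> real"
  assumes P: "markov_semigroup P"
begin

lemma semigroup_C0: "0 \<le> t \<Longrightarrow> f \<in> C0_S \<Longrightarrow> P t f \<in> C0_S"
  using P by (simp add: markov_semigroup_def)

lemma semigroup_lincomb:
  "0 \<le> t \<Longrightarrow> f \<in> C0_S \<Longrightarrow> g \<in> C0_S \<Longrightarrow>
    P t (\<lambda>p. a * f p + b * g p) = (\<lambda>p. a * P t f p + b * P t g p)"
  using P by (simp add: markov_semigroup_def)

lemma semigroup_zero: "f \<in> C0_S \<Longrightarrow> P 0 f = f"
  using P by (simp add: markov_semigroup_def)

lemma semigroup_add: "0 \<le> s \<Longrightarrow> 0 \<le> t \<Longrightarrow> f \<in> C0_S \<Longrightarrow> P (s + t) f = P s (P t f)"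
  using P by (simp add: markov_semigroup_def)

lemma semigroup_unit_interval:
  "0 \<le> t \<Longrightarrow> f \<in> C0_S \<Longrightarrow> (\<And>p. 0 \<le> f p \<and> f p \<le> 1) \<Longrightarrow> 0 \<le> P t f p \<and> P t f p \<le> 1"
  using P unfolding markov_semigroup_def by blast

text \<open>Positivity is available only for functions with values in \<open>[0,1]\<close>. The
  positive and negative parts of \<open>f / m\<close> are such functions, and so are their images,
  whose difference is therefore at most 1 in absolute value.\<close>

lemma semigroup_contraction:
  assumes t: "0 \<le> t" and f: "f \<in> C0_S" and m: "\<And>p. \<bar>f p\<bar> \<le> m"
  shows "\<bar>P t f p\<bar> \<le> m"
proof (cases "m = 0")
  case True
  then have "f = (\<lambda>p. 0 * f p + 0 * f p)"
    using m by (auto simp: fun_eq_iff)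
  then have "P t f = (\<lambda>p. 0 * P t f p + 0 * P t f p)"
    using semigroup_lincomb[OF t f f, of 0 0] by simp
  then show ?thesis
    using True by (simp only: mult_zero_left add_0_left abs_zero)
next
  case False
  moreover have "0 \<le> m"
    using m[of p] by simp
  ultimately have mpos: "m > 0"
    by simp
  define u where "u = (\<lambda>p. max 0 (1 / m * f p))"
  define v where "v = (\<lambda>p. max 0 (- 1 / m * f p))"
  have uv: "u \<in> C0_S" "v \<in> C0_S"
    unfolding u_def v_def by (intro C0_S_positive_part f)+
  have b: "0 \<le> u q \<and> u q \<le> 1" "0 \<le> v q \<and> v q \<le> 1" for q
    using m[of q] mpos by (auto simp: u_def v_def field_simps abs_le_iff)
  have f_eq: "f = (\<lambda>p. m * u p + (- m) * v p)"
  proof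
    fix q
    show "f q = m * u q + (- m) * v q"
      using mpos by (cases "f q \<ge> 0") (auto simp: u_def v_def max_def field_simps)
  qed
  have "P t f p = m * P t u p + (- m) * P t v p"
    by (subst f_eq) (simp only: semigroup_lincomb[OF t uv])
  then have "P t f p = m * (P t u p - P t v p)"
    by (simp add: algebra_simps)
  moreover have "\<bar>P t u p - P t v p\<bar> \<le> 1"
    using semigroup_unit_interval[OF t uv(1) b(1), of p] semigroup_unit_interval[OF t uv(2) b(2), of p] by auto
  ultimately show ?thesis
    using mpos by (simp add: abs_mult mult_left_le)
qed

lemma pairing_semigroup_abs_le:
  assumes "0 \<le> t" "f \<in> C0_S" "\<psi> \<in> Cc_infty" "\<And>p. \<bar>f p\<bar> \<le> m"
  shows "\<bar>pairing (P t f) (lift_S \<psi>)\<bar> \<le> 2 * (LINT x|lborel. \<bar>\<psi> x\<bar>) * m"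
  by (intro pairing_abs_le semigroup_C0 semigroup_contraction assms)

lemma pairing_semigroup_lincomb:
  assumes "0 \<le> t" "f \<in> C0_S" "g \<in> C0_S" "\<psi> \<in> Cc_infty"
  shows "pairing (P t (\<lambda>p. a * f p + b * g p)) (lift_S \<psi>) =
    a * pairing (P t f) (lift_S \<psi>) + b * pairing (P t g) (lift_S \<psi>)"
  using assms by (simp add: semigroup_lincomb pairing_lincomb semigroup_C0)

text \<open>For a step to the right of \<open>s\<close> the difference quotient is \<open>P s\<close> applied to the one at time
  0; for a step to the left, from \<open>s\<close> to \<open>r\<close>, it is \<open>P r\<close> applied to the one at time 0, and
  \<open>P r g\<close> has to be compared with \<open>P s g = P r (P (s - r) g)\<close>.\<close>

lemma pairing_semigroup_deriv:
  assumes gen: "generator P f g" and s: "0 \<le> s" and \<psi>: "\<psi> \<in> Cc_infty"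
  shows "((\<lambda>s. pairing (P s f) (lift_S \<psi>)) has_real_derivative pairing (P s g) (lift_S \<psi>)) (at s within {0..})"
proof -
  have f: "f \<in> C0_S" and g: "g \<in> C0_S"
    and lim: "uniform_limit UNIV (\<lambda>t p. (P t f p - f p) / t) g (at_right 0)"
    using gen by (auto simp: generator_def)
  have cont: "uniform_limit UNIV (\<lambda>t. P t g) g (at_right 0)"
    using P g by (simp add: markov_semigroup_def)
  define J where "J = 2 * (LINT x|lborel. \<bar>\<psi> x\<bar>)"
  have J: "J \<ge> 0"
    by (simp add: J_def)
  define \<Phi> where "\<Phi> t u = pairing (P t u) (lift_S \<psi>)" for t u
  \<comment> \<open>The first-order remainder at time 0. Applying \<open>P t\<close> transports it
    to time \<open>t\<close> by the semigroup law, and contraction preserves its smallness.\<close>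
  define rem where "rem h = (\<lambda>p. 1 * (1 * P h f p + (- 1) * f p) + (- h) * g p)" for h
  have rem: "rem h \<in> C0_S" "\<And>t. 0 \<le> t \<Longrightarrow> \<Phi> t (rem h) = \<Phi> (t + h) f - \<Phi> t f - h * \<Phi> t g"
    if h: "0 \<le> h" for h
  proof -
    show "rem h \<in> C0_S"
      unfolding rem_def by (intro C0_S_lincomb semigroup_C0 h f g)
    fix t :: real assume t: "0 \<le> t"
    have "\<Phi> t (rem h) = 1 * (1 * \<Phi> t (P h f) + (- 1) * \<Phi> t f) + (- h) * \<Phi> t g"
      unfolding rem_def \<Phi>_def
      by (simp only: pairing_semigroup_lincomb C0_S_lincomb semigroup_C0 h t f g \<psi>)
    also have "\<Phi> t (P h f) = \<Phi> (t + h) f"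
      unfolding \<Phi>_def by (simp add: semigroup_add t h f)
    finally show "\<Phi> t (rem h) = \<Phi> (t + h) f - \<Phi> t f - h * \<Phi> t g"
      by simp
  qed
  have "((\<lambda>r. (\<Phi> r f - \<Phi> s f) / (r - s)) \<longlongrightarrow> \<Phi> s g) (at s within {0..})"
    unfolding tendsto_iff
  proof (intro allI impI)
    fix e :: real assume e: "e > 0"
    \<comment> \<open>A step to the left produces two errors of size \<open>J * \<epsilon>\<close>
      per unit of time; the added 1 avoids division by zero and makes the final inequality
      strict.\<close>
    define \<epsilon> where "\<epsilon> = e / (2 * J + 1)"
    have \<epsilon>: "\<epsilon> > 0" "2 * J * \<epsilon> < e"
      using e J by (auto simp: \<epsilon>_def field_simps)
    have "\<forall>\<^sub>F h in at_right 0. (\<forall>p. dist ((P h f p - f p) / h) (g p) < \<epsilon>) \<and> (\<forall>p. dist (P h g p) (g p) < \<epsilon>)"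
      using eventually_conj[OF uniform_limitD[OF lim \<epsilon>(1)] uniform_limitD[OF cont \<epsilon>(1)]] by simp
    then obtain d where d: "d > 0" "\<And>h p. 0 < h \<Longrightarrow> h < d \<Longrightarrow> dist ((P h f p - f p) / h) (g p) < \<epsilon>"
        "\<And>h p. 0 < h \<Longrightarrow> h < d \<Longrightarrow> dist (P h g p) (g p) < \<epsilon>"
      unfolding eventually_at_right_field by blast
    have rem_le: "\<bar>rem h p\<bar> \<le> h * \<epsilon>" if "0 < h" "h < d" for h p
    proof -
      have "rem h p = h * ((P h f p - f p) / h - g p)"
        using that by (simp add: rem_def field_simps)
      then have "\<bar>rem h p\<bar> = h * dist ((P h f p - f p) / h) (g p)"
        using that by (simp add: abs_mult dist_real_def)
      then show ?thesis
        using d(2)[OF that, of p] that by simp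
    qed
    have \<Phi>_rem: "\<bar>\<Phi> t (rem h)\<bar> \<le> J * (h * \<epsilon>)" if "0 < h" "h < d" "0 \<le> t" for h t
      unfolding \<Phi>_def J_def using that
      by (intro pairing_semigroup_abs_le rem(1) rem_le \<psi>) auto
    show "\<forall>\<^sub>F r in at s within {0..}. dist ((\<Phi> r f - \<Phi> s f) / (r - s)) (\<Phi> s g) < e"
      unfolding eventually_at
    proof (intro exI[of _ d] conjI ballI impI d)
      fix r :: real assume "r \<in> {0..}" and "r \<noteq> s \<and> dist r s < d"
      then have r: "0 \<le> r" "r \<noteq> s" "\<bar>r - s\<bar> < d"
        by (auto simp: dist_real_def)
      have "\<bar>\<Phi> r f - \<Phi> s f - (r - s) * \<Phi> s g\<bar> \<le> \<bar>r - s\<bar> * (2 * J * \<epsilon>)"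
      proof (cases "s < r")
        case True
        then have "\<bar>\<Phi> r f - \<Phi> s f - (r - s) * \<Phi> s g\<bar> \<le> J * ((r - s) * \<epsilon>)"
          using \<Phi>_rem[of "r - s" s] rem(2)[of "r - s" s] r s by simp
        also have "\<dots> \<le> 2 * (J * ((r - s) * \<epsilon>))"
          using J True \<epsilon>(1) by simp
        finally show ?thesis
          using True by (simp add: mult_ac)
      next
        case False
        then have h: "0 < s - r" "s - r < d" "0 \<le> s - r"
          using r by auto
        have 1: "\<bar>\<Phi> s f - \<Phi> r f - (s - r) * \<Phi> r g\<bar> \<le> J * ((s - r) * \<epsilon>)"
          using \<Phi>_rem[OF h(1,2) r(1)] rem(2)[of "s - r" r] h r by simp
        have "\<Phi> s g - \<Phi> r g = \<Phi> r (\<lambda>p. 1 * P (s - r) g p + (- 1) * g p)"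
          unfolding \<Phi>_def pairing_semigroup_lincomb[OF r(1) semigroup_C0[OF h(3) g] g \<psi>]
          using semigroup_add[OF r(1) h(3) g] by simp
        also have "\<bar>\<dots>\<bar> \<le> J * \<epsilon>"
          unfolding \<Phi>_def J_def
          using less_imp_le[OF d(3)[OF h(1,2)]]
          by (intro pairing_semigroup_abs_le C0_S_lincomb semigroup_C0 r h(3) g \<psi>)
             (simp add: dist_real_def)
        finally have "(s - r) * \<bar>\<Phi> s g - \<Phi> r g\<bar> \<le> (s - r) * (J * \<epsilon>)"
          using h by (intro mult_left_mono) auto
        then have 2: "\<bar>(s - r) * (\<Phi> s g - \<Phi> r g)\<bar> \<le> (s - r) * (J * \<epsilon>)"
          using h by (simp add: abs_mult)
        have "\<Phi> r f - \<Phi> s f - (r - s) * \<Phi> s g =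
          - (\<Phi> s f - \<Phi> r f - (s - r) * \<Phi> r g) + (s - r) * (\<Phi> s g - \<Phi> r g)"
          by (simp add: algebra_simps)
        then have "\<bar>\<Phi> r f - \<Phi> s f - (r - s) * \<Phi> s g\<bar> \<le> J * ((s - r) * \<epsilon>) + (s - r) * (J * \<epsilon>)"
          using 1 2 by linarith
        then show ?thesis
          using h by (simp add: mult_ac)
      qed
      then have "\<bar>(\<Phi> r f - \<Phi> s f - (r - s) * \<Phi> s g) / (r - s)\<bar> \<le> 2 * J * \<epsilon>"
        unfolding abs_divide using r by (subst pos_divide_le_eq) (auto simp: mult.commute)
      moreover have "(\<Phi> r f - \<Phi> s f - (r - s) * \<Phi> s g) / (r - s) = (\<Phi> r f - \<Phi> s f) / (r - s) - \<Phi> s g"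
        using r by (simp add: diff_divide_distrib)
      ultimately show "dist ((\<Phi> r f - \<Phi> s f) / (r - s)) (\<Phi> s g) < e"
        using \<epsilon>(2) unfolding dist_real_def by linarith
    qed
  qed
  then show ?thesis
    by (simp add: has_field_derivative_iff \<Phi>_def)
qed

end

text \<open>The constant sequence \<open>f\<close> witnesses membership in the closure of the graph
  of \<open>A_op\<close>.\<close>

lemma generates_generator:
  assumes "generates (A_op \<kappa> lam \<gamma>) P" "f \<in> Cc_infty_S"
  shows "generator P f (A_op \<kappa> lam \<gamma> f)"
proof -
  note iff = assms(1)[unfolded generates_def, THEN conjunct2, THEN spec[of _ f], THEN spec[of _ "A_op \<kappa> lam \<gamma> f"]]
  show ?thesis
    by (rule iffD2[OF iff], rule exI[of _ "\<lambda>_. f"]) (simp add: assms(2) uniform_limit_const)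
qed

theorem mainTheorem3:
  fixes \<kappa> lam \<gamma> \<rho> t :: real
    and M :: "'w measure"
    and Y :: "real \<Rightarrow> 'w \<Rightarrow> (real \<times> spin \<Rightarrow> real) \<Rightarrow> real"
    and P :: "real \<Rightarrow> (real \<times> spin \<Rightarrow> real) \<Rightarrow> real \<times> spin \<Rightarrow> real"
    and \<phi> \<psi> :: "real \<Rightarrow> real"
  assumes "\<kappa> \<ge> 0" and "lam \<ge> 0" and "\<gamma> > 0" and "\<rho> \<ge> 0"
    and "prob_space M"
    and "dual_process M Y"
    and "stationary_process M Y"
    and "centered_gaussian_process M Y"
    and "\<And>f g. f \<in> Cc_infty_S \<Longrightarrow> g \<in> Cc_infty_S \<Longrightarrow>
           (LINT w|M. Y 0 w f * Y 0 w g) = \<rho> * pairing f g"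
    and "solves_SPDE \<kappa> lam \<gamma> \<rho> M Y"
    and "generates (A_op \<kappa> lam \<gamma>) P"
    and "t \<ge> 0" and "\<phi> \<in> Cc_infty" and "\<psi> \<in> Cc_infty"
  shows "(LINT w|M. total_density (Y t w) \<phi> * total_density (Y 0 w) \<psi>)
           = \<rho> * pairing (P t (lift_S \<phi>)) (lift_S \<psi>)"
proof -
  interpret S: stationary_spde_solution M \<kappa> lam \<gamma> \<rho> Y
    using assms by (intro stationary_spde_solution.intro stationary_spde_solution_axioms.intro) auto
  have sg: "markov_semigroup P"
    using assms(11) by (simp add: generates_def)
  have single: "single \<sigma> \<phi> \<in> Cc_infty_S" "single \<sigma> \<psi> \<in> Cc_infty_S" for \<sigma>
    using assms(13,14) by (auto intro: single_in_Cc_infty_S)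
  define G where "G w = 1 * Y 0 w (single Plus \<psi>) + 1 * Y 0 w (single Minus \<psi>)" for w
  have G_filtration: "G \<in> borel_measurable (natural_filtration M Y 0)"
    unfolding G_def
    by (intro borel_measurable_add borel_measurable_times borel_measurable_const
        S.Y_0_measurable_filtration single)
  have lift: "lift_S \<psi> \<in> Cc_infty_S"
    by (rule lift_S_in_Cc_infty_S) fact
  \<comment> \<open>Linearity of the functional holds only for outcomes in \<open>space M\<close>,
    so \<open>G\<close> is defined by the explicit sum and identified with the lifted test function
    there.\<close>
  have G_lift: "G w = Y 0 w (lift_S \<psi>)" if "w \<in> space M" for w
    unfolding G_def lift_S_conv_single by (simp only: S.Y_lincomb[OF order_refl that single(2) single(2)])
  have G_square: "integrable M (\<lambda>w. (G w)\<^sup>2)"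
    using S.Y_square_integrable[OF order_refl lift]
    by (rule Bochner_Integration.integrable_cong[THEN iffD1, rotated 2]) (auto simp: G_lift)
  note corr = G_filtration G_square
  define D where "D s f = S.corr G s f - \<rho> * pairing (P s f) (lift_S \<psi>)" for s f
  \<comment> \<open>It is enough to treat functions carried by one spin, since the lift of
    \<open>\<phi>\<close> is the sum of two of them.\<close>
  have zero: "D t (single \<sigma> \<phi>) = 0" for \<sigma>
  proof (rule weak_solution_zero[of \<kappa> \<gamma> D lam])
    show "\<kappa> \<ge> 0" "\<gamma> \<ge> 0" "t \<ge> 0" "\<phi> \<in> Cc_infty"
      using assms by auto
    show "D s (\<lambda>p. a * f p + b * g p) = a * D s f + b * D s g"
      if "0 \<le> s" "f \<in> Cc_infty_S" "g \<in> Cc_infty_S" for s f g a b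
      using that assms(14)
      by (simp add: D_def S.corr_lincomb[OF corr] pairing_semigroup_lincomb[OF sg]
          Cc_infty_S_subset_C0_S algebra_simps)
    show "((\<lambda>s. D s f) has_real_derivative D s (A_op \<kappa> lam \<gamma> f)) (at s within {0..})"
      if "0 \<le> s" "f \<in> Cc_infty_S" for s f
      unfolding D_def
      by (intro DERIV_diff DERIV_cmult S.corr_deriv[OF corr] that assms(14)
          pairing_semigroup_deriv[OF sg] generates_generator[OF assms(11)])
    show "D 0 f = 0" if f: "f \<in> Cc_infty_S" for f
    proof -
      have "S.corr G 0 f = (LINT w|M. Y 0 w f * Y 0 w (lift_S \<psi>))"
        unfolding S.corr_def[OF corr]
        by (intro Bochner_Integration.integral_cong refl) (simp add: G_lift)
      then show ?thesis
        using assms(9)[OF f lift] semigroup_zero[OF sg Cc_infty_S_subset_C0_S[OF f]]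
        by (simp add: D_def)
    qed
    fix L :: real
    obtain C where "C \<ge> 0" and C: "\<And>s f c m. 0 \<le> s \<Longrightarrow> f \<in> Cc_infty_S \<Longrightarrow>
        (\<forall>x \<sigma>. L < \<bar>x - c\<bar> \<longrightarrow> f (x, \<sigma>) = 0) \<Longrightarrow> (\<forall>p. \<bar>f p\<bar> \<le> m) \<Longrightarrow> \<bar>S.corr G s f\<bar> \<le> C * m"
      using S.corr_bound[OF corr, of L] by blast
    define J where "J = 2 * (LINT x|lborel. \<bar>\<psi> x\<bar>)"
    show "\<exists>C\<ge>0. \<forall>s\<ge>0. \<forall>f\<in>Cc_infty_S. \<forall>c m. (\<forall>x \<sigma>. L < \<bar>x - c\<bar> \<longrightarrow> f (x, \<sigma>) = 0) \<longrightarrow>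
       (\<forall>p. \<bar>f p\<bar> \<le> m) \<longrightarrow> \<bar>D s f\<bar> \<le> C * m"
    \<comment> \<open>\<open>C\<close> comes from the second moments and depends on
      \<open>L\<close>; \<open>\<rho> * J\<close> comes from the contraction property and holds for
      every support.\<close>
    proof (intro exI[of _ "C + \<rho> * J"] conjI allI ballI impI)
      show "0 \<le> C + \<rho> * J"
        using \<open>C \<ge> 0\<close> \<open>\<rho> \<ge> 0\<close> by (simp add: J_def)
      fix s c m :: real and f
      assume s: "0 \<le> s" and f: "f \<in> Cc_infty_S"
        and supp: "\<forall>x \<sigma>. L < \<bar>x - c\<bar> \<longrightarrow> f (x, \<sigma>) = 0" and m: "\<forall>p. \<bar>f p\<bar> \<le> m"
      have "\<bar>pairing (P s f) (lift_S \<psi>)\<bar> \<le> J * m"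
        unfolding J_def
        by (rule pairing_semigroup_abs_le[OF sg s Cc_infty_S_subset_C0_S[OF f] assms(14)]) (use m in blast)
      then have "\<bar>\<rho> * pairing (P s f) (lift_S \<psi>)\<bar> \<le> \<rho> * (J * m)"
        using \<open>\<rho> \<ge> 0\<close> by (simp add: abs_mult mult_left_mono)
      then show "\<bar>D s f\<bar> \<le> (C + \<rho> * J) * m"
        using C[OF s f supp m] unfolding D_def distrib_right mult.assoc by linarith
    qed
  qed
  have "(LINT w|M. total_density (Y t w) \<phi> * total_density (Y 0 w) \<psi>)
      = (LINT w|M. Y t w (single Plus \<phi>) * G w + Y t w (single Minus \<phi>) * G w)"
    by (intro Bochner_Integration.integral_cong refl)
       (simp add: total_density_def component_def G_def algebra_simps)
  also have "\<dots> = S.corr G t (single Plus \<phi>) + S.corr G t (single Minus \<phi>)"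
    using S.integrable_Y_G[OF corr assms(12) single(1)] by (simp add: S.corr_def[OF corr])
  also have "\<dots> = \<rho> * (1 * pairing (P t (single Plus \<phi>)) (lift_S \<psi>) + 1 * pairing (P t (single Minus \<phi>)) (lift_S \<psi>))"
    using zero[of Plus] zero[of Minus] by (simp add: D_def algebra_simps)
  also have "\<dots> = \<rho> * pairing (P t (lift_S \<phi>)) (lift_S \<psi>)"
    unfolding lift_S_conv_single[of \<phi>]
    by (subst pairing_semigroup_lincomb[OF sg assms(12)])
       (auto intro: Cc_infty_S_subset_C0_S single assms(14))
  finally show ?thesis .
qed

end
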